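(* Fix $c \in \mathbb{R}$ and let $$p = p(n) = \frac{1}{2}\left( 1 + \frac{\log n + c}{n} \right).$$ Let $Q \sim Q_2(n,p)$ and let $\beta_1 = \dim H_1(Q;\mathbb{R})$. Then for every integer $k \ge 0$, $$\lim_{n\to\infty}\mathbb{P}( \beta_1 = k) = \frac{e^{-ck}e^{-e^{-c}}}{k!}.$$
   Context: $Q^n=[0,1]^n$ is the $n$-dimensional cube with its standard cubical (face) structure, with vertex set $\{0,1\}^n$; $Q^n_k$ denotes its $k$-skeleton. The random $2$-dimensional cubical complex $Q_2(n,p)$ has $1$-skeleton equal to $Q^n_1$, and each $2$-dimensional face of $Q^n$ is included independently with probability $p$. For $n$ large, $p(n)\in[0,1]$. $\log$ is the natural logarithm. *)

theory Defs
  imports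
    "HOL-Analysis.Finite_Function_Topology"
    "HOL-Probability.Probability"
    "Jordan_Normal_Form.VS_Connect"
begin

text \<open>
  A face of \<open>[0,1]^n\<close> is a product of \<open>n\<close> factors, each being \<open>[0,1]\<close>, \<open>{1}\<close> or \<open>{0}\<close>.
  It is encoded as the pair \<open>(S, v)\<close> of the set \<open>S\<close> of coordinates whose factor is \<open>[0,1]\<close> and
  the set \<open>v\<close> of coordinates whose factor is \<open>{1}\<close>; coordinates are numbered \<open>0, \<dots>, n - 1\<close>.
\<close>

type_synonym face = "nat set \<times> nat set"

definition face_dim :: "face \<Rightarrow> nat" where
  "face_dim f = card (fst f)"

definition cube_faces :: "nat \<Rightarrow> nat \<Rightarrow> face set" where
  "cube_faces n k =
     {(S, v). S \<subseteq> {..<n} \<and> v \<subseteq> {..<n} \<and> S \<inter> v = {} \<and> card S = k}"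

definition cube_skeleton :: "nat \<Rightarrow> nat \<Rightarrow> face set" where
  "cube_skeleton n k = (\<Union>j\<le>k. cube_faces n j)"

text \<open>
  Cellular (cubical) homology with real coefficients of a set \<open>X\<close> of faces. The oriented boundary
  of a face is
  \<open>\<partial>(I\<^sub>0 \<times> \<dots>) = \<Sum>\<^sub>i (-1)^{#free coordinates before i} (face at x\<^sub>i = 1 - face at x\<^sub>i = 0)\<close>,
  the sum ranging over the free coordinates \<open>i\<close>.
\<close>

type_synonym chain = "face \<Rightarrow>\<^sub>0 real"

definition chains :: "face set \<Rightarrow> nat \<Rightarrow> chain set" where
  "chains X k = {c. Poly_Mapping.keys c \<subseteq> {f \<in> X. face_dim f = k}}"

definition face_boundary :: "face \<Rightarrow> chain" where
  "face_boundary f = (case f of (S, v) \<Rightarrow>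
     \<Sum>i\<in>S. (-1) ^ card {j \<in> S. j < i} *\<^sub>R
       (Poly_Mapping.single (S - {i}, insert i v) 1 - Poly_Mapping.single (S - {i}, v) 1))"

definition boundary :: "chain \<Rightarrow> chain" where
  "boundary c = (\<Sum>f\<in>Poly_Mapping.keys c. Poly_Mapping.lookup c f *\<^sub>R face_boundary f)"

definition cycles :: "face set \<Rightarrow> nat \<Rightarrow> chain set" where
  "cycles X k = {c \<in> chains X k. boundary c = 0}"

definition boundaries :: "face set \<Rightarrow> nat \<Rightarrow> chain set" where
  "boundaries X k = boundary ` chains X (Suc k)"

text \<open>
  The quotient vector space of cycles by boundaries; its elements are the cosets. The summand \<open>b\<close>
  in the scalar multiplication makes the multiple of a coset by \<open>0\<close> again a coset. The
  multiplicative fields of the record play no role for a module.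
\<close>

definition homology :: "face set \<Rightarrow> nat \<Rightarrow> (real, chain set) module" where
  "homology X k =
     \<lparr> carrier = (\<lambda>z. {z + b | b. b \<in> boundaries X k}) ` cycles X k,
       mult = undefined,
       one = undefined,
       zero = boundaries X k,
       add = (\<lambda>A B. {x + y | x y. x \<in> A \<and> y \<in> B}),
       smult = (\<lambda>r A. {r *\<^sub>R x + b | x b. x \<in> A \<and> b \<in> boundaries X k}) \<rparr>"

definition betti :: "face set \<Rightarrow> nat \<Rightarrow> nat" where
  "betti X k = vectorspace.dim class_ring (homology X k)"

text \<open>
  \<open>Q\<^sub>2(n,p)\<close>, as a distribution on sets of faces. For \<open>p\<close> outside \<open>[0,1]\<close>, \<^const>\<open>bernoulli_pmf\<close>
  truncates \<open>p\<close> to \<open>[0,1]\<close>.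
\<close>

definition random_cubical_complex :: "nat \<Rightarrow> real \<Rightarrow> face set pmf" where
  "random_cubical_complex n p =
     map_pmf (\<lambda>\<omega>. cube_skeleton n 1 \<union> {f \<in> cube_faces n 2. \<omega> f})
       (Pi_pmf (cube_faces n 2) False (\<lambda>_. bernoulli_pmf p))"


text \<open>The library's dimension applies: the quotient is indeed a vector space.\<close>

lemma boundary_superset:
  assumes "finite A" "Poly_Mapping.keys c \<subseteq> A"
  shows "boundary c = (\<Sum>f\<in>A. Poly_Mapping.lookup c f *\<^sub>R face_boundary f)"
  unfolding boundary_def using assms
  by (intro sum.mono_neutral_left) (auto simp: in_keys_iff)

lemma lookup_scaleR_chain:
  "Poly_Mapping.lookup (r *\<^sub>R c) f = r * Poly_Mapping.lookup (c :: chain) f"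
proof -
  have "finite {i. r *\<^sub>R Poly_Mapping.lookup c i \<noteq> 0}"
    by (rule finite_subset[of _ "Poly_Mapping.keys c"]) (auto simp: in_keys_iff)
  then show ?thesis by (simp add: scaleR_poly_mapping_def)
qed

lemma keys_scaleR_chain: "Poly_Mapping.keys (r *\<^sub>R c) \<subseteq> Poly_Mapping.keys (c :: chain)"
  by (auto simp: in_keys_iff lookup_scaleR_chain)

lemma linear_boundary: "linear boundary"
proof (rule linearI)
  fix c d :: chain
  let ?A = "Poly_Mapping.keys c \<union> Poly_Mapping.keys d"
  have "boundary (c + d) = (\<Sum>f\<in>?A. Poly_Mapping.lookup (c + d) f *\<^sub>R face_boundary f)"
    by (rule boundary_superset) (auto simp: keys_add)
  also have "\<dots> = boundary c + boundary d"
    using boundary_superset[of ?A c] boundary_superset[of ?A d]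
    by (simp add: lookup_add scaleR_add_left sum.distrib)
  finally show "boundary (c + d) = boundary c + boundary d" .
next
  fix r and c :: chain
  have "boundary (r *\<^sub>R c) =
      (\<Sum>f\<in>Poly_Mapping.keys c. Poly_Mapping.lookup (r *\<^sub>R c) f *\<^sub>R face_boundary f)"
    by (rule boundary_superset) (auto simp: keys_scaleR_chain[THEN subsetD])
  then show "boundary (r *\<^sub>R c) = r *\<^sub>R boundary c"
    by (simp add: lookup_scaleR_chain boundary_def scaleR_sum_right)
qed

lemma subspace_chains: "real_vector.subspace (chains X k)"
proof (rule real_vector.subspaceI)
  show "0 \<in> chains X k" by (simp add: chains_def)
  show "c + d \<in> chains X k" if "c \<in> chains X k" "d \<in> chains X k" for c d
    using that Poly_Mapping.keys_add[of c d] by (auto simp: chains_def)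
  show "r *\<^sub>R c \<in> chains X k" if "c \<in> chains X k" for r c
    using that keys_scaleR_chain[of r c] by (auto simp: chains_def)
qed

lemma subspace_cycles: "real_vector.subspace (cycles X k)"
  using subspace_chains[of X k] linear_boundary
  by (simp add: cycles_def real_vector.subspace_def linear_0 linear_add linear_scale)

lemma subspace_boundaries: "real_vector.subspace (boundaries X k)"
  unfolding boundaries_def
  by (rule real_vector.linear_subspace_image[OF linear_boundary subspace_chains])

lemma vectorspace_homology: "vectorspace class_ring (homology X k)"
proof -
  define B where "B = boundaries X k"
  define Z where "Z = cycles X k"
  define co where "co z = {z + b | b. b \<in> B}" for z :: chain
  note B = subspace_boundaries[of X k, folded B_def]
  note Z = subspace_cycles[of X k, folded Z_def]
  have car: "carrier (homology X k) = co ` Z"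
    by (simp add: homology_def co_def B_def Z_def)
  have zero: "\<zero>\<^bsub>homology X k\<^esub> = co 0"
    by (simp add: homology_def co_def B_def)
  have add: "co x \<oplus>\<^bsub>homology X k\<^esub> co y = co (x + y)" for x y
  proof -
    have "co x \<oplus>\<^bsub>homology X k\<^esub> co y = {(x + b) + (y + b') | b b'. b \<in> B \<and> b' \<in> B}"
      by (auto simp: homology_def co_def)
    also have "\<dots> = co (x + y)"
    proof (intro equalityI subsetI)
      fix w assume "w \<in> {(x + b) + (y + b') | b b'. b \<in> B \<and> b' \<in> B}"
      then obtain b b' where "w = (x + y) + (b + b')" "b \<in> B" "b' \<in> B"
        by (auto simp: algebra_simps)
      then show "w \<in> co (x + y)"
        using real_vector.subspace_add[OF B] by (auto simp: co_def)
    next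
      fix w assume "w \<in> co (x + y)"
      then obtain b where "w = (x + b) + (y + 0)" "b \<in> B" by (auto simp: co_def algebra_simps)
      then show "w \<in> {(x + b) + (y + b') | b b'. b \<in> B \<and> b' \<in> B}"
        using real_vector.subspace_0[OF B] by blast
    qed
    finally show ?thesis .
  qed
  have smult: "r \<odot>\<^bsub>homology X k\<^esub> co x = co (r *\<^sub>R x)" for r x
  proof -
    have "r \<odot>\<^bsub>homology X k\<^esub> co x = {r *\<^sub>R (x + b) + b' | b b'. b \<in> B \<and> b' \<in> B}"
      by (auto simp: homology_def co_def B_def)
    also have "\<dots> = co (r *\<^sub>R x)"
    proof (intro equalityI subsetI)
      fix w assume "w \<in> {r *\<^sub>R (x + b) + b' | b b'. b \<in> B \<and> b' \<in> B}"
      then obtain b b' where "w = r *\<^sub>R x + (r *\<^sub>R b + b')" "b \<in> B" "b' \<in> B"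
        by (auto simp: algebra_simps)
      then show "w \<in> co (r *\<^sub>R x)"
        using real_vector.subspace_add[OF B] real_vector.subspace_scale[OF B]
        by (auto simp: co_def)
    next
      fix w assume "w \<in> co (r *\<^sub>R x)"
      then obtain b where "w = r *\<^sub>R (x + 0) + b" "b \<in> B" by (auto simp: co_def)
      then show "w \<in> {r *\<^sub>R (x + b) + b' | b b'. b \<in> B \<and> b' \<in> B}"
        using real_vector.subspace_0[OF B] by blast
    qed
    finally show ?thesis .
  qed
  have Z0: "0 \<in> Z" and Zadd: "\<And>x y. x \<in> Z \<Longrightarrow> y \<in> Z \<Longrightarrow> x + y \<in> Z"
    and Zscale: "\<And>r x. x \<in> Z \<Longrightarrow> r *\<^sub>R x \<in> Z" and Zneg: "\<And>x. x \<in> Z \<Longrightarrow> - x \<in> Z"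
    using Z real_vector.subspace_neg by (auto simp: real_vector.subspace_def)
  have "abelian_group (homology X k)"
  proof (rule abelian_groupI)
    fix x assume "x \<in> carrier (homology X k)"
    then obtain z where z: "z \<in> Z" "x = co z" by (auto simp: car)
    show "\<exists>y\<in>carrier (homology X k). y \<oplus>\<^bsub>homology X k\<^esub> x = \<zero>\<^bsub>homology X k\<^esub>"
      by (rule bexI[of _ "co (- z)"]) (use z Zneg in \<open>auto simp: car add zero\<close>)
  qed (auto simp: car zero add Z0 Zadd ac_simps)
  moreover have "field (class_ring :: real ring)"
    by (rule class_field)
  ultimately show ?thesis
    unfolding vectorspace_def
    by (intro conjI moduleI)
       (auto simp: car zero add smult Zscale algebra_simps intro: field.is_ring fieldE)
qed

end

theory Submission
  imports Defs "HOL-Real_Asymp.Real_Asymp"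
begin

text \<open>
  Call an edge isolated if no square of the complex contains it. The first Betti number is, with
  probability tending to one, exactly the number of isolated edges, and that number is
  asymptotically Poisson with mean \<open>e\<^sup>-\<^sup>c\<close>.

  Homology. The cycles of the full \<open>1\<close>-skeleton are spanned by the boundaries of all squares of the
  cube (\<open>cycle_in_span_square_boundaries\<close>), so only the classes of the boundaries of the missing
  squares matter. The six squares of a \<open>3\<close>-cube satisfy one relation with coefficients
  \<open>\<plusminus>1\<close>, so a square is null-homologous as soon as the other five are. Suppose every square
  without isolated edges is null-homologous and isolated edges are far apart. Then all squares at one
  isolated edge \<open>e\<close> have the same class up to sign. These classes, one per isolated edge, form a
  basis of the first homology, because the coefficient at \<open>e\<close> vanishes on all boundaries
  (\<open>betti_eq_card_isolated\<close>).

  Why squares without isolated edges are null-homologous. Call an edge sparse if it lies in fewer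
  than \<open>n/1000\<close> squares of the complex. For an edge \<open>e\<close>, join two directions if the four squares not
  containing \<open>e\<close> of the \<open>3\<close>-cube that they span with \<open>e\<close> are present; then the squares at \<open>e\<close> in
  these two directions are null-homologous together or not at all. This graph on the directions is
  a binomial random graph with constant edge probability, so the probability that some partition of
  the directions into two parts of linear size is crossed by no edge is \<open>exp(-\<Omega>(n\<^sup>2))\<close>. This is small
  enough for a union bound over all edges of the cube. The directions at \<open>e\<close> whose squares are
  null-homologous are never joined to the other directions. If \<open>e\<close> is not sparse, there are
  linearly many of them, namely at least those of the present squares, hence they are almost all directions.

  Therefore a square \<open>F\<close> without sparse edges that is not null-homologous passes this defect on to
  almost all of its parallel translates, and again to almost all translates of these: almost all of
  about \<open>n\<^sup>2/2\<close> squares would be missing, which has probability \<open>exp(-\<Omega>(n\<^sup>2))\<close>. Finally, two given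
  edges are both sparse with probability exponentially smaller than \<open>2\<^sup>-\<^sup>n\<close>, while the number of
  pairs of edges close to each other is \<open>2\<^sup>n\<close> times a polynomial, so sparse edges are far apart. Hence
  a square with a sparse edge \<open>e\<close> that is not isolated shares a \<open>3\<close>-cube with a present square at
  \<open>e\<close>, and the other four squares of that \<open>3\<close>-cube have no sparse
  edges. The locale \<open>robust_complex\<close> collects the three properties, and
  \<open>prob_not_robust_tendsto_0\<close> bounds their failure.

  Poisson limit. The expected number of \<open>r\<close>-element sets of isolated edges is a sum of
  \<open>(1-p)\<^sup>m\<close>, where \<open>m\<close> is the number of squares containing an edge of the set. Two different edges share at
  most one square and each edge shares a square with only \<open>O(n)\<close> others, so these moments converge to
  those of the Poisson distribution, and the Bonferroni inequalities turn this into convergence of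
  probabilities (\<open>poisson_limit_of_binomial_moments\<close>).
\<close>

section \<open>Boundaries of squares\<close>

text \<open>
  The cells that occur in \<open>face_boundary\<close>, with orientations forgotten: the combinatorial part of the
  proof only has to know which squares bound a common \<open>3\<close>-cube.
\<close>

definition facets :: "face \<Rightarrow> face set" where
  "facets f = (case f of (T, w) \<Rightarrow> \<Union>a\<in>T. {(T - {a}, w), (T - {a}, insert a w)})"

abbreviation cell :: "face \<Rightarrow> chain" where
  "cell f \<equiv> Poly_Mapping.single f 1"

lemma face_boundary_edge: "face_boundary ({i}, v) = cell ({}, insert i v) - cell ({}, v)"
proof -
  have c: "card {j \<in> {i}. j < i} = 0" by (simp add: card_eq_0_iff)
  have "face_boundary ({i}, v) = (-1) ^ card {j \<in> {i}. j < i} *\<^sub>R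
       (cell ({i} - {i}, insert i v) - cell ({i} - {i}, v))"
    by (simp add: face_boundary_def)
  then show ?thesis unfolding c by simp
qed

lemma face_boundary_square:
  assumes "a < b"
  shows "face_boundary ({a, b}, v) =
    (cell ({b}, insert a v) - cell ({b}, v)) - (cell ({a}, insert b v) - cell ({a}, v))"
proof -
  have 1: "{j \<in> {a,b}. j < a} = {}" "{j \<in> {a,b}. j < b} = {a}" using assms by auto
  have 2: "{a,b} - {a} = {b}" "{a,b} - {b} = {a}" using assms by auto
  have "face_boundary ({a, b}, v) = (\<Sum>i\<in>{a,b}. (-1) ^ card {j \<in> {a,b}. j < i} *\<^sub>R
       (cell ({a,b} - {i}, insert i v) - cell ({a,b} - {i}, v)))"
    by (simp add: face_boundary_def)
  also have "\<dots> = (-1) ^ card {j \<in> {a,b}. j < a} *\<^sub>R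
       (cell ({a,b} - {a}, insert a v) - cell ({a,b} - {a}, v)) + (-1) ^ card {j \<in> {a,b}. j < b} *\<^sub>R
       (cell ({a,b} - {b}, insert b v) - cell ({a,b} - {b}, v))"
    using assms by (subst sum.insert) auto
  also have "\<dots> = (cell ({b}, insert a v) - cell ({b}, v)) - (cell ({a}, insert b v) - cell ({a}, v))"
    by (simp only: 1 2) simp
  finally show ?thesis .
qed

text \<open>
  The identity \<open>\<partial>\<partial> = 0\<close> for a \<open>3\<close>-cube, read as a linear relation among the boundaries of its
  squares.
\<close>

lemma square_boundary_relation:
  assumes "a < b" "b < c"
  shows "(face_boundary ({b, c}, insert a w) - face_boundary ({b, c}, w))
       - (face_boundary ({a, c}, insert b w) - face_boundary ({a, c}, w))
       + (face_boundary ({a, b}, insert c w) - face_boundary ({a, b}, w)) = 0"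
  using assms by (simp add: face_boundary_square insert_commute)

lemma cube_faces_iff:
  "(S, v) \<in> cube_faces n k \<longleftrightarrow> S \<subseteq> {..<n} \<and> v \<subseteq> {..<n} \<and> S \<inter> v = {} \<and> card S = k"
  by (auto simp: cube_faces_def)

lemma finite_cube_faces: "finite (cube_faces n k)"
  by (rule finite_subset[of _ "Pow {..<n} \<times> Pow {..<n}"]) (auto simp: cube_faces_def)

lemma cube_face_1E:
  assumes "e \<in> cube_faces n 1"
  obtains i v where "e = ({i}, v)" "i < n" "v \<subseteq> {..<n}" "i \<notin> v"
proof (cases e)
  case (Pair S v)
  then obtain i where "S = {i}" using assms by (auto simp: cube_faces_iff card_1_singleton_iff)
  then show ?thesis using that assms Pair by (auto simp: cube_faces_iff)
qed

lemma cube_face_2E: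
  assumes "F \<in> cube_faces n 2"
  obtains a b v where "F = ({a, b}, v)" "a < b" "b < n" "v \<subseteq> {..<n}" "a \<notin> v" "b \<notin> v"
proof (cases F)
  case (Pair S v)
  then obtain x y where xy: "S = {x, y}" "x \<noteq> y" using assms by (auto simp: cube_faces_iff card_2_iff)
  then show ?thesis using that[of "min x y" "max x y" v] assms Pair
    by (auto simp: cube_faces_iff min_def max_def insert_commute split: if_splits)
qed

lemma facets_square:
  assumes "a \<noteq> b"
  shows "facets ({a, b}, v) = {({b}, v), ({b}, insert a v), ({a}, v), ({a}, insert b v)}"
proof -
  have "{a,b} - {a} = {b}" "{a,b} - {b} = {a}" using assms by auto
  then show ?thesis by (auto simp: facets_def)
qed

lemma facets_cube:
  assumes "a \<noteq> b" "b \<noteq> c" "a \<noteq> c"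
  shows "facets ({a, b, c}, v) = {({b, c}, v), ({b, c}, insert a v), ({a, c}, v), ({a, c}, insert b v),
     ({a, b}, v), ({a, b}, insert c v)}"
proof -
  have "{a,b,c} - {a} = {b,c}" "{a,b,c} - {b} = {a,c}" "{a,b,c} - {c} = {a,b}" using assms by auto
  then show ?thesis by (auto simp: facets_def)
qed

lemma facets_in_cube_faces:
  assumes "f \<in> cube_faces n (Suc k)" "g \<in> facets f"
  shows "g \<in> cube_faces n k"
proof -
  obtain T w where f: "f = (T, w)" by (cases f)
  with assms have "finite T" by (auto simp: cube_faces_iff intro: finite_subset)
  with assms f show ?thesis by (auto simp: cube_faces_iff facets_def)
qed

lemma finite_facets: "f \<in> cube_faces n k \<Longrightarrow> finite (facets f)"
  by (auto simp: cube_faces_def facets_def intro: finite_subset[of _ "{..<n}"])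

lemma edge_facet_iff:
  assumes "({i}, v) \<in> cube_faces n 1" "F \<in> cube_faces n 2"
  shows "({i}, v) \<in> facets F \<longleftrightarrow> (\<exists>j<n. j \<noteq> i \<and> F = ({i, j}, v - {j}))"
proof
  obtain a b w where F: "F = ({a, b}, w)" "a < b" "b < n" "w \<subseteq> {..<n}" "a \<notin> w" "b \<notin> w"
    using cube_face_2E[OF assms(2)] by metis
  assume "({i}, v) \<in> facets F"
  then consider "i = b" "v = w" | "i = b" "v = insert a w" | "i = a" "v = w" | "i = a" "v = insert b w"
    using F by (auto simp: facets_square)
  then show "\<exists>j<n. j \<noteq> i \<and> F = ({i, j}, v - {j})"
  proof cases
    case 1
    then show ?thesis using F by (intro exI[of _ a]) auto
  next
    case 2
    then show ?thesis using F by (intro exI[of _ a]) auto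
  next
    case 3
    then show ?thesis using F by (intro exI[of _ b]) auto
  next
    case 4
    then show ?thesis using F by (intro exI[of _ b]) auto
  qed
next
  assume "\<exists>j<n. j \<noteq> i \<and> F = ({i, j}, v - {j})"
  then obtain j where "j \<noteq> i" "F = ({i, j}, v - {j})" by auto
  then show "({i}, v) \<in> facets F"
    by (cases "j \<in> v") (auto simp: facets_square insert_absorb)
qed

lemma square_of_edge_in_cube_faces:
  assumes "({i}, v) \<in> cube_faces n 1" "j < n" "j \<noteq> i"
  shows "({i, j}, v - {j}) \<in> cube_faces n 2"
  using assms by (auto simp: cube_faces_iff)

text \<open>
  Only the invertibility of the coefficients matters from here on, so the orientation signs are
  hidden in an unspecified \<open>\<epsilon>\<close>.
\<close>

lemma cube_boundary_relation:
  assumes "C \<in> cube_faces n 3"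
  obtains \<epsilon> :: "face \<Rightarrow> real" where "\<And>F. F \<in> facets C \<Longrightarrow> \<epsilon> F = 1 \<or> \<epsilon> F = - 1"
    "(\<Sum>F\<in>facets C. \<epsilon> F *\<^sub>R face_boundary F) = 0"
proof -
  obtain T w where C: "C = (T, w)" by (cases C)
  with assms have T: "finite T" "card T = 3" "T \<inter> w = {}"
    by (auto simp: cube_faces_iff intro: finite_subset)
  obtain x y z where xyz: "T = {x,y,z}" "x \<noteq> y" "y \<noteq> z" "x \<noteq> z" using T by (auto simp: card_3_iff)
  have "\<exists>a b c. T = {a,b,c} \<and> a < b \<and> b < c"
  proof -
    consider "x < y" "y < z" | "x < z" "z < y" | "y < x" "x < z" | "y < z" "z < x" | "z < x" "x < y" | "z < y" "y < x"
      using xyz by linarith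
    then show ?thesis by cases (use xyz in \<open>metis insert_commute\<close>)+
  qed
  then obtain a b c where abc: "T = {a,b,c}" "a < b" "b < c" by auto
  define \<epsilon> :: "face \<Rightarrow> real" where
    "\<epsilon> F = (if fst F = {a, c} then -1 else 1) * (if snd F = w then -1 else 1)" for F
  have d: "a \<notin> w" "b \<notin> w" "c \<notin> w" using T abc by auto
  have ne: "{b, c} \<noteq> {a, c}" "{a, b} \<noteq> {a, c}" "{b, c} \<noteq> {a, b}" "insert a w \<noteq> w" "insert b w \<noteq> w" "insert c w \<noteq> w"
    using abc d by (auto simp: doubleton_eq_iff)
  have "(\<Sum>F\<in>facets C. \<epsilon> F *\<^sub>R face_boundary F) = 0"
    using square_boundary_relation[OF abc(2,3), of w] ne abc(2,3)
    unfolding C abc(1) by (subst facets_cube) (auto simp: \<epsilon>_def algebra_simps)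
  moreover have "\<epsilon> F = 1 \<or> \<epsilon> F = - 1" for F by (auto simp: \<epsilon>_def)
  ultimately show ?thesis using that by blast
qed

text \<open>
  The property of the set of null-homologous squares through which topology enters the
  combinatorial argument.
\<close>

definition cube_closed :: "nat \<Rightarrow> face set \<Rightarrow> bool" where
  "cube_closed n N \<longleftrightarrow> (\<forall>C\<in>cube_faces n 3. \<forall>F\<in>facets C. facets C - {F} \<subseteq> N \<longrightarrow> F \<in> N)"

text \<open>
  Modulo \<open>B\<close>, the relation of the cube involves only the two squares whose boundaries may lie
  outside \<open>B\<close>.
\<close>

lemma boundary_eq_up_to_sign:
  assumes B: "real_vector.subspace B" and C: "C \<in> cube_faces n 3"
    and F: "F \<in> facets C" "G \<in> facets C" "F \<noteq> G"
    and null: "\<And>H. H \<in> facets C \<Longrightarrow> H \<noteq> F \<Longrightarrow> H \<noteq> G \<Longrightarrow> face_boundary H \<in> B"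
  obtains s :: real where "face_boundary F - s *\<^sub>R face_boundary G \<in> B"
proof -
  \<comment> \<open>solve the relation of the cube for the boundary of F\<close>
  obtain \<epsilon> :: "face \<Rightarrow> real" where \<epsilon>: "\<And>F. F \<in> facets C \<Longrightarrow> \<epsilon> F = 1 \<or> \<epsilon> F = - 1"
    "(\<Sum>F\<in>facets C. \<epsilon> F *\<^sub>R face_boundary F) = 0"
    using cube_boundary_relation[OF C] by metis
  define R where "R = (\<Sum>H\<in>facets C - {F} - {G}. \<epsilon> H *\<^sub>R face_boundary H)"
  have fin: "finite (facets C)" using C by (rule finite_facets)
  have R: "R \<in> B" unfolding R_def
    by (intro real_vector.subspace_sum[OF B] real_vector.subspace_scale[OF B] null) auto
  have "\<epsilon> F *\<^sub>R face_boundary F + (\<epsilon> G *\<^sub>R face_boundary G + R) = 0"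
    using \<epsilon>(2) F fin unfolding R_def by (subst (asm) sum.remove[of _ F], simp, simp) (subst (asm) sum.remove[of _ G], auto)
  then have "\<epsilon> F *\<^sub>R (\<epsilon> F *\<^sub>R face_boundary F + (\<epsilon> G *\<^sub>R face_boundary G + R)) = 0" by simp
  then have "(\<epsilon> F * \<epsilon> F) *\<^sub>R face_boundary F = - (\<epsilon> F * \<epsilon> G) *\<^sub>R face_boundary G - \<epsilon> F *\<^sub>R R"
    by (simp add: scaleR_add_right eq_neg_iff_add_eq_0 algebra_simps)
  moreover have "\<epsilon> F * \<epsilon> F = 1" using \<epsilon>(1)[OF F(1)] by auto
  ultimately have "face_boundary F - (- (\<epsilon> F * \<epsilon> G)) *\<^sub>R face_boundary G = - \<epsilon> F *\<^sub>R R" by simp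
  then have "face_boundary F - (- (\<epsilon> F * \<epsilon> G)) *\<^sub>R face_boundary G \<in> B"
    using real_vector.subspace_scale[OF B R] by metis
  then show ?thesis using that by blast
qed

lemma cube_closed_null_squares:
  assumes B: "real_vector.subspace B"
  shows "cube_closed n {F \<in> cube_faces n 2. face_boundary F \<in> B}"
  unfolding cube_closed_def
proof (intro ballI impI)
  fix C F assume C: "C \<in> cube_faces n 3" and F: "F \<in> facets C"
    and sub: "facets C - {F} \<subseteq> {F \<in> cube_faces n 2. face_boundary F \<in> B}"
  have F2: "F \<in> cube_faces n 2" using facets_in_cube_faces[of C n 2 F] C F by (simp add: numeral_3_eq_3 numeral_2_eq_2)
  obtain T w where Tw: "C = (T, w)" by (cases C)
  with C have T: "card T = 3" "T \<inter> w = {}" by (auto simp: cube_faces_iff)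
  obtain a where "a \<in> T" using T by (metis card.empty equals0I zero_neq_numeral)
  then have "(T - {a}, w) \<in> facets C" "(T - {a}, insert a w) \<in> facets C" "w \<noteq> insert a w" using Tw T by (auto simp: facets_def)
  then obtain G where G: "G \<in> facets C" "G \<noteq> F" by (metis Pair_inject)
  obtain s where s: "face_boundary F - s *\<^sub>R face_boundary G \<in> B"
    using boundary_eq_up_to_sign[OF B C F G(1)] sub G by blast
  have "face_boundary G \<in> B" using sub G by auto
  then have "(face_boundary F - s *\<^sub>R face_boundary G) + s *\<^sub>R face_boundary G \<in> B"
    using s by (intro real_vector.subspace_add[OF B] real_vector.subspace_scale[OF B])
  then show "F \<in> {F \<in> cube_faces n 2. face_boundary F \<in> B}" using F2 by simp
qed

lemma lookup_sum_chain: "Poly_Mapping.lookup (\<Sum>x\<in>A. g x :: chain) f = (\<Sum>x\<in>A. Poly_Mapping.lookup (g x) f)"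
  by (induction A rule: infinite_finite_induct) (auto simp: lookup_add)

lemma lookup_square_boundary:
  assumes "F \<in> cube_faces n 2"
  shows "Poly_Mapping.lookup (face_boundary F) e \<noteq> 0 \<longleftrightarrow> e \<in> facets F"
proof -
  obtain a b v where F: "F = ({a, b}, v)" "a < b" "a \<notin> v" "b \<notin> v"
    using cube_face_2E[OF assms] by metis
  have "insert a v \<noteq> v" "insert b v \<noteq> v" using F by auto
  then show ?thesis using F(2-)
    unfolding F(1) by (subst facets_square) (auto simp: face_boundary_square lookup_minus lookup_single when_def split: if_splits)
qed

lemma square_boundary_cycle:
  assumes "F \<in> cube_faces n 2" "cube_faces n 1 \<subseteq> X"
  shows "face_boundary F \<in> cycles X 1"
proof -
  obtain a b v where F: "F = ({a, b}, v)" "a < b" "b < n" "v \<subseteq> {..<n}" "a \<notin> v" "b \<notin> v"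
    using cube_face_2E[OF assms(1)] by metis
  have b1: "boundary (cell f) = face_boundary f" for f by (simp add: boundary_def)
  have "boundary (face_boundary F) = 0"
    using F(2) unfolding F(1)
    by (simp add: face_boundary_square linear_diff[OF linear_boundary] b1 face_boundary_edge insert_commute)
  moreover have "face_boundary F \<in> chains X 1"
  proof -
    have "e \<in> X \<and> face_dim e = 1" if "Poly_Mapping.lookup (face_boundary F) e \<noteq> 0" for e
    proof -
      have "e \<in> cube_faces n 1"
        using that lookup_square_boundary[OF assms(1)] facets_in_cube_faces[of F n 1 e] assms(1)
        by (simp add: numeral_2_eq_2)
      then show ?thesis using assms(2) by (cases e) (auto simp: cube_faces_iff face_dim_def)
    qed
    then show ?thesis by (auto simp: chains_def in_keys_iff)
  qed
  ultimately show ?thesis by (simp add: cycles_def)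
qed

text \<open>
  The cube has no first homology. By induction on the dimension, a cycle is pushed along the last
  coordinate into the face where that coordinate is \<open>0\<close>: adding suitable squares removes all edges
  inside the opposite face, and then no edge in the last direction can remain, since it would be the
  only edge at its upper end point.
\<close>

lemma cycle_in_span_square_boundaries:
  "Poly_Mapping.keys z \<subseteq> cube_faces n 1 \<Longrightarrow> boundary z = 0 \<Longrightarrow> z \<in> span (face_boundary ` cube_faces n 2)"
proof (induction n arbitrary: z)
  case 0
  have "cube_faces 0 1 = {}" by (auto simp: cube_faces_def)
  then have "z = 0" using 0(1) by (simp only: subset_empty keys_eq_empty)
  then show ?case by (simp add: span_zero)
next
  case (Suc n)
  define S where "S = span (face_boundary ` cube_faces (Suc n) 2)"
  have S: "real_vector.subspace S" unfolding S_def by (rule real_vector.subspace_span)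
  have mono: "span (face_boundary ` cube_faces n 2) \<subseteq> S"
    unfolding S_def by (intro span_mono image_mono) (auto simp: cube_faces_def)
  define T where "T = {f \<in> cube_faces (Suc n) 1. fst f \<noteq> {n} \<and> n \<in> snd f}"
  have finT: "finite T" unfolding T_def using finite_cube_faces by simp
  \<comment> \<open>push the edges of the top layer down through the squares below them\<close>
  define h where "h = (\<Sum>f\<in>T. Poly_Mapping.lookup z f *\<^sub>R face_boundary (insert n (fst f), snd f - {n}))"
  define sq where "sq f = (insert n (fst f), snd f - {n})" for f :: face
  have sq: "sq f \<in> cube_faces (Suc n) 2 \<and> (\<forall>e\<in>T. Poly_Mapping.lookup (face_boundary (sq f)) e = (if e = f then -1 else 0))"
    if "f \<in> T" for f
  proof -
    have "f \<in> cube_faces (Suc n) 1" using that by (simp add: T_def)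
    then obtain i v where f: "f = ({i}, v)" "i < Suc n" "v \<subseteq> {..<Suc n}" "i \<notin> v"
      using cube_face_1E by blast
    with that have i: "i < n" "n \<in> v" by (auto simp: T_def)
    have eq: "sq f = ({i, n}, v - {n})" using f by (auto simp: sq_def)
    have "v - {n} \<noteq> v" "v \<noteq> insert i v" using i f by auto
    then have "Poly_Mapping.lookup (face_boundary (sq f)) e = (if e = f then -1 else 0)" if "e \<in> T" for e
      using that i f unfolding eq
      by (auto simp: face_boundary_square lookup_minus lookup_single when_def T_def insert_absorb)
    moreover have "sq f \<in> cube_faces (Suc n) 2" unfolding eq using f i by (auto simp: cube_faces_iff)
    ultimately show ?thesis by blast
  qed
  have h_eq: "h = (\<Sum>f\<in>T. Poly_Mapping.lookup z f *\<^sub>R face_boundary (sq f))" by (simp add: h_def sq_def)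
  have hS: "h \<in> S" unfolding h_eq
    by (intro subspace_sum[OF S] subspace_scale[OF S]) (use sq in \<open>auto simp: S_def intro!: span_base\<close>)
  define y where "y = z + h"
  have h_top: "Poly_Mapping.lookup h e = - Poly_Mapping.lookup z e" if "e \<in> T" for e
  proof -
    have "Poly_Mapping.lookup h e = (\<Sum>f\<in>T. if e = f then - Poly_Mapping.lookup z f else 0)"
      unfolding h_eq lookup_sum_chain lookup_scaleR_chain using sq that by (intro sum.cong) auto
    then show ?thesis using that finT by simp
  qed
  have hc: "h \<in> cycles (cube_faces (Suc n) 1) 1"
    unfolding h_eq
    by (intro subspace_sum[OF subspace_cycles] subspace_scale[OF subspace_cycles] square_boundary_cycle[of _ "Suc n"]) (use sq in auto)
  have y0: "boundary y = 0" using Suc.prems(2) hc by (simp add: y_def linear_add[OF linear_boundary] cycles_def)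
  have yk: "Poly_Mapping.keys y \<subseteq> cube_faces (Suc n) 1"
    using Suc.prems(1) hc keys_add[of z h] by (auto simp: y_def cycles_def chains_def)
  have yT: "e \<notin> T" if "e \<in> Poly_Mapping.keys y" for e
    using that h_top[of e] by (auto simp: y_def in_keys_iff lookup_add)
  \<comment> \<open>a vertical edge is now the only edge at its top vertex\<close>
  have yv: "Poly_Mapping.lookup y ({n}, v) = 0" if "({n}, v) \<in> Poly_Mapping.keys y" for v
  proof -
    have "Poly_Mapping.lookup (face_boundary e) ({}, insert n v) = (if e = ({n}, v) then 1 else 0)"
      if e: "e \<in> Poly_Mapping.keys y" for e
    proof -
      obtain i w where ei: "e = ({i}, w)" "i < Suc n" "w \<subseteq> {..<Suc n}" "i \<notin> w"
        using e yk cube_face_1E[of e "Suc n"] by blast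
      have "({n}, v) \<in> cube_faces (Suc n) 1" using that yk \<open>({n}, v) \<in> Poly_Mapping.keys y\<close> by blast
      then have v: "n \<notin> v" by (auto simp: cube_faces_iff)
      have "i \<noteq> n \<Longrightarrow> n \<notin> w" using yT[OF e] yk e unfolding T_def ei by auto
      then have "insert i w = insert n v \<longleftrightarrow> i = n \<and> w = v" "w \<noteq> insert n v"
        using ei(4) v by (metis insert_iff insert_ident)+
      then show ?thesis using ei v by (auto simp: face_boundary_edge lookup_minus lookup_single when_def)
    qed
    then have "Poly_Mapping.lookup (boundary y) ({}, insert n v) = 
        (\<Sum>e\<in>Poly_Mapping.keys y. if e = ({n}, v) then Poly_Mapping.lookup y e else 0)"
      unfolding boundary_def lookup_sum_chain lookup_scaleR_chain by (intro sum.cong) auto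
    also have "\<dots> = Poly_Mapping.lookup y ({n}, v)" using that by (simp add: sum.delta)
    finally show ?thesis using y0 by simp
  qed
  have "Poly_Mapping.keys y \<subseteq> cube_faces n 1"
  proof
    fix e assume e: "e \<in> Poly_Mapping.keys y"
    obtain i w where ei: "e = ({i}, w)" "i < Suc n" "w \<subseteq> {..<Suc n}" "i \<notin> w"
      using e yk cube_face_1E[of e "Suc n"] by blast
    have "i \<noteq> n" using yv e ei by (auto simp: in_keys_iff)
    moreover have "n \<notin> w" using yT[OF e] yk e \<open>i \<noteq> n\<close> unfolding T_def ei by auto
    ultimately show "e \<in> cube_faces n 1" using ei by (auto simp: cube_faces_iff less_Suc_eq)
  qed
  then have "y \<in> S" using Suc.IH y0 mono by blast
  then have "y - h \<in> S" using hS by (rule subspace_diff[OF S])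
  then show ?case by (simp add: y_def S_def)
qed

section \<open>First homology and isolated edges\<close>

definition coset :: "face set \<Rightarrow> nat \<Rightarrow> chain \<Rightarrow> chain set" where
  "coset X k z = {z + b | b. b \<in> boundaries X k}"

lemma coset_eq_iff: "coset X k x = coset X k y \<longleftrightarrow> x - y \<in> boundaries X k"
proof
  note B = subspace_boundaries[of X k]
  assume eq: "coset X k x = coset X k y"
  have "x \<in> coset X k x" using subspace_0[OF B] by (auto simp: coset_def intro!: exI[of _ 0])
  then have "x \<in> coset X k y" by (simp only: eq)
  then obtain b where "b \<in> boundaries X k" "x = y + b" by (auto simp: coset_def)
  then show "x - y \<in> boundaries X k" by simp
next
  note B = subspace_boundaries[of X k]
  have sub: "coset X k x \<subseteq> coset X k y" if "x - y \<in> boundaries X k" for x y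
  proof
    fix w assume "w \<in> coset X k x"
    then obtain b where b: "b \<in> boundaries X k" "w = x + b" by (auto simp: coset_def)
    then have "w = y + ((x - y) + b)" by simp
    then show "w \<in> coset X k y" using subspace_add[OF B that b(1)]
      unfolding coset_def by blast
  qed
  assume "x - y \<in> boundaries X k"
  then show "coset X k x = coset X k y"
    using sub[of x y] sub[of y x] subspace_neg[OF B, of "x - y"] by auto
qed

lemma homology_simps:
  "carrier (homology X k) = coset X k ` cycles X k"
  "\<zero>\<^bsub>homology X k\<^esub> = coset X k 0"
  "coset X k x \<oplus>\<^bsub>homology X k\<^esub> coset X k y = coset X k (x + y)"
  "r \<odot>\<^bsub>homology X k\<^esub> coset X k x = coset X k (r *\<^sub>R x)"
proof -
  note B = subspace_boundaries[of X k]
  show "carrier (homology X k) = coset X k ` cycles X k" "\<zero>\<^bsub>homology X k\<^esub> = coset X k 0"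
    by (auto simp: homology_def coset_def)
  show "coset X k x \<oplus>\<^bsub>homology X k\<^esub> coset X k y = coset X k (x + y)"
  proof (intro equalityI subsetI)
    fix w assume "w \<in> coset X k x \<oplus>\<^bsub>homology X k\<^esub> coset X k y"
    then obtain b b' where "b \<in> boundaries X k" "b' \<in> boundaries X k" "w = (x + y) + (b + b')"
      by (auto simp: homology_def coset_def algebra_simps)
    then show "w \<in> coset X k (x + y)" using subspace_add[OF B] by (auto simp: coset_def)
  next
    fix w assume "w \<in> coset X k (x + y)"
    then obtain b where "b \<in> boundaries X k" "w = (x + b) + (y + 0)" by (auto simp: coset_def algebra_simps)
    then show "w \<in> coset X k x \<oplus>\<^bsub>homology X k\<^esub> coset X k y"
      using subspace_0[OF B] unfolding homology_def coset_def by force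
  qed
  show "r \<odot>\<^bsub>homology X k\<^esub> coset X k x = coset X k (r *\<^sub>R x)"
  proof (intro equalityI subsetI)
    fix w assume "w \<in> r \<odot>\<^bsub>homology X k\<^esub> coset X k x"
    then obtain b b' where "b \<in> boundaries X k" "b' \<in> boundaries X k" "w = r *\<^sub>R x + (r *\<^sub>R b + b')"
      by (auto simp: homology_def coset_def algebra_simps)
    then show "w \<in> coset X k (r *\<^sub>R x)"
      using subspace_add[OF B] subspace_scale[OF B] by (auto simp: coset_def)
  next
    fix w assume "w \<in> coset X k (r *\<^sub>R x)"
    then obtain b where "b \<in> boundaries X k" "w = r *\<^sub>R (x + 0) + b" by (auto simp: coset_def)
    then show "w \<in> r \<odot>\<^bsub>homology X k\<^esub> coset X k x"
      using subspace_0[OF B] unfolding homology_def coset_def by force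
  qed
qed

text \<open>
  The coordinates at \<open>I\<close> vanish on boundaries, so they descend to homology, where they form a dual
  family to the classes of the cycles \<open>z e\<close>. This gives linear independence; the last hypothesis says
  that the classes span.
\<close>

lemma betti_eq_card:
  fixes z :: "face \<Rightarrow> chain"
  assumes finI: "finite I" and cyc: "\<And>e. e \<in> I \<Longrightarrow> z e \<in> cycles X k"
    and dual: "\<And>e e'. e \<in> I \<Longrightarrow> e' \<in> I \<Longrightarrow> Poly_Mapping.lookup (z e) e' = (if e = e' then 1 else 0)"
    and bd: "\<And>b e. b \<in> boundaries X k \<Longrightarrow> e \<in> I \<Longrightarrow> Poly_Mapping.lookup b e = 0"
    and gen: "\<And>y. y \<in> cycles X k \<Longrightarrow> y - (\<Sum>e\<in>I. Poly_Mapping.lookup y e *\<^sub>R z e) \<in> boundaries X k"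
  shows "betti X k = card I"
proof -
  interpret vectorspace class_ring "homology X k" by (rule vectorspace_homology)
  define f where "f e = coset X k (z e)" for e
  have look: "Poly_Mapping.lookup (\<Sum>e\<in>I. a e *\<^sub>R z e) e' = a e'" if "e' \<in> I" for a e'
  proof -
    have "Poly_Mapping.lookup (\<Sum>e\<in>I. a e *\<^sub>R z e) e' = (\<Sum>e\<in>I. if e = e' then a e else 0)"
      unfolding lookup_sum_chain lookup_scaleR_chain using dual that by (intro sum.cong) auto
    then show ?thesis using that finI by simp
  qed
  have inj: "inj_on f I"
  proof
    fix x y assume xy: "x \<in> I" "y \<in> I" "f x = f y"
    then have "Poly_Mapping.lookup (z x - z y) x = 0" by (intro bd) (auto simp: f_def coset_eq_iff)
    then show "x = y" using xy dual by (auto simp: lookup_minus split: if_splits)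
  qed
  have fcar: "f ` I \<subseteq> carrier (homology X k)" using cyc by (auto simp: homology_simps f_def)
  have comb: "lincomb a (f ` J) = coset X k (\<Sum>e\<in>J. a (f e) *\<^sub>R z e)" if "J \<subseteq> I" for J and a
    using finite_subset[OF that finI] that
  proof (induction J rule: finite_induct)
    case empty
    then show ?case by (simp add: lincomb_def homology_simps)
  next
    case (insert x J)
    have "f x \<notin> f ` J" using inj insert by (auto simp: inj_on_def)
    moreover have "(\<lambda>v. a v \<odot>\<^bsub>homology X k\<^esub> v) \<in> f ` J \<rightarrow> carrier (homology X k)"
      using fcar insert by (auto intro!: smult_closed simp: image_subset_iff subset_iff)
    moreover have "a (f x) \<odot>\<^bsub>homology X k\<^esub> f x \<in> carrier (homology X k)"
      using fcar insert by auto
    ultimately have "lincomb a (f ` insert x J) = a (f x) \<odot>\<^bsub>homology X k\<^esub> f x \<oplus>\<^bsub>homology X k\<^esub> lincomb a (f ` J)"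
      unfolding lincomb_def using insert by simp
    then show ?case using insert by (simp add: f_def homology_simps)
  qed
  have "basis (f ` I)" unfolding basis_def
  proof (intro conjI)
    show "f ` I \<subseteq> carrier (homology X k)" by fact
    show "lin_indpt (f ` I)"
    proof (rule finite_lin_indpt2)
      show "finite (f ` I)" using finI by simp
      show "f ` I \<subseteq> carrier (homology X k)" by fact
      fix a assume "lincomb a (f ` I) = \<zero>\<^bsub>homology X k\<^esub>"
      then have "(\<Sum>e\<in>I. a (f e) *\<^sub>R z e) - 0 \<in> boundaries X k"
        unfolding comb[OF order_refl] homology_simps coset_eq_iff .
      then have "Poly_Mapping.lookup (\<Sum>e\<in>I. a (f e) *\<^sub>R z e) e = 0" if "e \<in> I" for e using bd that by simp
      then show "\<forall>v\<in>f ` I. a v = \<zero>\<^bsub>class_ring\<^esub>" using look[of _ "\<lambda>e. a (f e)"] by simp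
    qed
    show "gen_set (f ` I)"
    proof
      show "span (f ` I) \<subseteq> carrier (homology X k)" using fcar by (rule span_is_subset2)
      show "carrier (homology X k) \<subseteq> span (f ` I)"
      proof
        fix w assume "w \<in> carrier (homology X k)"
        then obtain y where y: "y \<in> cycles X k" "w = coset X k y" by (auto simp: homology_simps)
        define a where "a v = Poly_Mapping.lookup y (the_inv_into I f v)" for v
        have "lincomb a (f ` I) = coset X k (\<Sum>e\<in>I. Poly_Mapping.lookup y e *\<^sub>R z e)"
          unfolding comb[OF order_refl] by (intro arg_cong[of _ _ "coset X k"] sum.cong) (auto simp: a_def the_inv_into_f_f[OF inj])
        also have "\<dots> = w" unfolding y coset_eq_iff[of X k] using subspace_neg[OF subspace_boundaries gen[OF y(1)]] by simp
        finally show "w \<in> span (f ` I)" unfolding span_def using finI by (auto intro!: exI[of _ a] exI[of _ "f ` I"])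
      qed
    qed
  qed
  then have "betti X k = card (f ` I)" unfolding betti_def using finI by (intro dim_basis) auto
  then show ?thesis using inj by (simp add: card_image)
qed

text \<open>
  This \<open>3\<close>-cube serves to compare the classes of two squares at the same edge \<open>e\<close>: of its other four
  squares none contains \<open>e\<close>.
\<close>

lemma common_cube_of_squares:
  assumes e: "e \<in> cube_faces n 1" and F: "F \<in> cube_faces n 2" "e \<in> facets F"
    and G: "G \<in> cube_faces n 2" "e \<in> facets G" and "F \<noteq> G"
  obtains C where "C \<in> cube_faces n 3" "F \<in> facets C" "G \<in> facets C"
    "\<And>H. H \<in> facets C \<Longrightarrow> e \<in> facets H \<Longrightarrow> H = F \<or> H = G"
proof -
  obtain i v where ei: "e = ({i}, v)" "i < n" "v \<subseteq> {..<n}" "i \<notin> v" using cube_face_1E[OF e] by metis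
  obtain j where j: "j < n" "j \<noteq> i" "F = ({i, j}, v - {j})" using edge_facet_iff[of i v n F] e F ei by blast
  obtain k where k: "k < n" "k \<noteq> i" "G = ({i, k}, v - {k})" using edge_facet_iff[of i v n G] e G ei by blast
  have jk: "j \<noteq> k" using \<open>F \<noteq> G\<close> j k by auto
  define C where "C = ({i, j, k}, v - {j, k})"
  have C: "C \<in> cube_faces n 3" unfolding C_def cube_faces_iff using ei j k jk by auto
  have fC: "facets C = {({j, k}, v - {j,k}), ({j, k}, insert i (v - {j,k})), ({i, k}, v - {j,k}), ({i, k}, insert j (v - {j,k})),
     ({i, j}, v - {j,k}), ({i, j}, insert k (v - {j,k}))}" unfolding C_def using j k jk by (intro facets_cube) auto
  have vj: "v - {j} = v - {j,k} \<or> v - {j} = insert k (v - {j,k})" using jk by auto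
  have vk: "v - {k} = v - {j,k} \<or> v - {k} = insert j (v - {j,k})" using jk by auto
  have "F \<in> facets C" using vj unfolding fC j by auto
  moreover have "G \<in> facets C" using vk unfolding fC k by auto
  moreover have "H = F \<or> H = G" if H: "H \<in> facets C" "e \<in> facets H" for H
  proof -
    have "H \<in> cube_faces n 2" using facets_in_cube_faces[of C n 2 H] C H by (simp add: numeral_3_eq_3 numeral_2_eq_2)
    then obtain l where l: "l \<noteq> i" "H = ({i, l}, v - {l})" using edge_facet_iff[of i v n H] e H ei by blast
    then have "{i, l} \<subseteq> {i, j, k}" using H(1) unfolding C_def facets_def by auto
    then show ?thesis using l j k by auto
  qed
  ultimately show ?thesis using that C by blast
qed

lemma square_through_edge:
  assumes "e \<in> cube_faces n 1" "n \<ge> 2"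
  obtains F where "F \<in> cube_faces n 2" "e \<in> facets F"
proof -
  obtain i v where ei: "e = ({i}, v)" "i < n" "v \<subseteq> {..<n}" "i \<notin> v" using cube_face_1E[OF assms(1)] by metis
  define j where "j = (if i = 0 then 1 else 0::nat)"
  have j: "j < n" "j \<noteq> i" using assms(2) by (auto simp: j_def)
  have "({i, j}, v - {j}) \<in> cube_faces n 2" by (rule square_of_edge_in_cube_faces) (use assms ei j in auto)
  then show ?thesis using that edge_facet_iff[of i v n] assms(1) j unfolding ei by blast
qed

definition isolated_edges :: "nat \<Rightarrow> face set \<Rightarrow> face set" where
  "isolated_edges n W = {e \<in> cube_faces n 1. \<forall>F\<in>W. e \<notin> facets F}"

text \<open>
  An isolated edge \<open>e\<close> contributes the class of the boundary of any square through \<open>e\<close>. Different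
  choices agree up to a scalar modulo boundaries, since in the common \<open>3\<close>-cube the other four squares contain
  no isolated edge: they do not contain \<open>e\<close>, and \<open>sep3\<close> keeps other isolated edges away. The classes
  are independent because no boundary of the complex involves an isolated edge.
\<close>

lemma betti_eq_card_isolated:
  assumes n: "n \<ge> 2" and W: "W \<subseteq> cube_faces n 2"
    and null: "\<And>N F. W \<subseteq> N \<Longrightarrow> cube_closed n N \<Longrightarrow> F \<in> cube_faces n 2 \<Longrightarrow>
      facets F \<inter> isolated_edges n W = {} \<Longrightarrow> F \<in> N"
    and sep2: "\<And>F e e'. F \<in> cube_faces n 2 \<Longrightarrow> e \<in> isolated_edges n W \<Longrightarrow> e' \<in> isolated_edges n W \<Longrightarrow>
      e \<in> facets F \<Longrightarrow> e' \<in> facets F \<Longrightarrow> e = e'"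
    and sep3: "\<And>C F G e e'. C \<in> cube_faces n 3 \<Longrightarrow> e \<in> isolated_edges n W \<Longrightarrow> e' \<in> isolated_edges n W \<Longrightarrow>
      F \<in> facets C \<Longrightarrow> G \<in> facets C \<Longrightarrow> e \<in> facets F \<Longrightarrow> e' \<in> facets G \<Longrightarrow> e = e'"
  shows "betti (cube_skeleton n 1 \<union> W) 1 = card (isolated_edges n W)"
proof -
  define Q where "Q = cube_skeleton n 1 \<union> W"
  define I where "I = isolated_edges n W"
  define B where "B = boundaries Q 1"
  note sB = subspace_boundaries[of Q 1, folded B_def]
  have finI: "finite I" unfolding I_def isolated_edges_def using finite_cube_faces by simp
  have I1: "e \<in> cube_faces n 1" if "e \<in> I" for e using that by (auto simp: I_def isolated_edges_def)
  have dim1: "{f \<in> Q. face_dim f = 1} = cube_faces n 1"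
    using W by (auto simp: Q_def cube_skeleton_def cube_faces_def face_dim_def)
  have dim2: "{f \<in> Q. face_dim f = Suc 1} = W"
    using W by (auto simp: Q_def cube_skeleton_def cube_faces_def face_dim_def)
  have skel: "cube_faces n 1 \<subseteq> Q" using dim1 by blast
  have WB: "face_boundary F \<in> B" if "F \<in> W" for F
  proof -
    have "cell F \<in> chains Q (Suc 1)" using that by (auto simp: chains_def dim2[symmetric])
    moreover have "boundary (cell F) = face_boundary F" by (simp add: boundary_def)
    ultimately show ?thesis unfolding B_def boundaries_def by (metis imageI)
  qed
  have Biso: "Poly_Mapping.lookup b e = 0" if b: "b \<in> B" and "e \<in> I" for b e
  proof -
    obtain c where c: "b = boundary c" "Poly_Mapping.keys c \<subseteq> W"
      using b unfolding B_def boundaries_def chains_def dim2 by blast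
    have "Poly_Mapping.lookup (face_boundary F) e = 0" if "F \<in> Poly_Mapping.keys c" for F
      using lookup_square_boundary[of F n e] that c W \<open>e \<in> I\<close> by (auto simp: I_def isolated_edges_def)
    then show ?thesis unfolding c boundary_def by (simp add: lookup_sum_chain lookup_scaleR_chain)
  qed
  have nullB: "face_boundary F \<in> B" if F: "F \<in> cube_faces n 2" "facets F \<inter> I = {}" for F
  proof -
    have "W \<subseteq> {F \<in> cube_faces n 2. face_boundary F \<in> B}" using WB W by blast
    from null[OF this cube_closed_null_squares[OF sB] F(1)] show ?thesis using F by (simp add: I_def)
  qed
  have "\<exists>F. e \<in> I \<longrightarrow> F \<in> cube_faces n 2 \<and> e \<in> facets F" for e
    using square_through_edge[of e n] I1 n by metis
  then obtain sq where sq: "\<And>e. e \<in> I \<Longrightarrow> sq e \<in> cube_faces n 2" "\<And>e. e \<in> I \<Longrightarrow> e \<in> facets (sq e)"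
    by metis
  \<comment> \<open>normalised to have coefficient 1 at e\<close>
  define z where "z e = (1 / Poly_Mapping.lookup (face_boundary (sq e)) e) *\<^sub>R face_boundary (sq e)" for e
  have nz: "Poly_Mapping.lookup (face_boundary (sq e)) e \<noteq> 0" if "e \<in> I" for e
    using lookup_square_boundary[OF sq(1)] sq(2) that by blast
  have zB: "face_boundary F - Poly_Mapping.lookup (face_boundary F) e *\<^sub>R z e \<in> B"
    if F: "F \<in> cube_faces n 2" "e \<in> facets F" "e \<in> I" for F e
  proof (cases "F = sq e")
    case True
    then show ?thesis using nz[OF F(3)] subspace_0[OF sB] by (simp add: z_def)
  next
    case False
    obtain C where C: "C \<in> cube_faces n 3" "F \<in> facets C" "sq e \<in> facets C"
      "\<And>H. H \<in> facets C \<Longrightarrow> e \<in> facets H \<Longrightarrow> H = F \<or> H = sq e"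
      using common_cube_of_squares[OF I1[OF F(3)] F(1,2) sq(1,2)[OF F(3)] False] by metis
    obtain s where s: "face_boundary F - s *\<^sub>R face_boundary (sq e) \<in> B"
    proof (rule boundary_eq_up_to_sign[OF sB C(1,2,3) False])
      fix H assume H: "H \<in> facets C" "H \<noteq> F" "H \<noteq> sq e"
      show "face_boundary H \<in> B"
      proof (rule nullB)
        show "H \<in> cube_faces n 2" using facets_in_cube_faces[of C n 2 H] C H by (simp add: numeral_3_eq_3 numeral_2_eq_2)
        show "facets H \<inter> I = {}" using sep3[OF C(1) _ _ C(2) H(1) F(2)] F(3) C(4)[OF H(1)] H unfolding I_def by blast
      qed
    qed
    have "Poly_Mapping.lookup (face_boundary F) e = s * Poly_Mapping.lookup (face_boundary (sq e)) e"
      using Biso[OF s F(3)] by (simp add: lookup_minus lookup_scaleR_chain)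
    then have "Poly_Mapping.lookup (face_boundary F) e *\<^sub>R z e = s *\<^sub>R face_boundary (sq e)"
      using nz[OF F(3)] by (simp add: z_def)
    then show ?thesis using s by simp
  qed
  have "betti Q 1 = card I"
  proof (rule betti_eq_card)
    show "finite I" by fact
    show "z e \<in> cycles Q 1" if "e \<in> I" for e
      unfolding z_def by (intro subspace_scale[OF subspace_cycles] square_boundary_cycle[OF sq(1)[OF that] skel])
    show "Poly_Mapping.lookup (z e) e' = (if e = e' then 1 else 0)" if "e \<in> I" "e' \<in> I" for e e'
      using nz[OF that(1)] lookup_square_boundary[OF sq(1)[OF that(1)], of e'] sep2[OF sq(1)[OF that(1)] _ _ sq(2)[OF that(1)], of e'] that
      by (auto simp: z_def lookup_scaleR_chain I_def)
    show "Poly_Mapping.lookup b e = 0" if "b \<in> boundaries Q 1" "e \<in> I" for b e using Biso that by (simp add: B_def)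
    fix y assume y: "y \<in> cycles Q 1"
    \<comment> \<open>it suffices to treat a generator y, because P is linear\<close>
    define P where "P = (\<lambda>y. y - (\<Sum>e\<in>I. Poly_Mapping.lookup y e *\<^sub>R z e))"
    have linP: "linear P"
      unfolding P_def by (rule linearI) (auto simp: lookup_add lookup_scaleR_chain algebra_simps sum.distrib scaleR_sum_right)
    have "y \<in> span (face_boundary ` cube_faces n 2)"
      by (rule cycle_in_span_square_boundaries) (use y dim1 in \<open>auto simp: cycles_def chains_def\<close>)
    then have "P y \<in> B"
    proof (induction rule: span_induct)
      case base
      then show ?case using linear_subspace_vimage[OF linP sB] by (simp add: vimage_def)
    next
      case (step x)
      then obtain F where F: "x = face_boundary F" "F \<in> cube_faces n 2" by auto
      show ?case
      proof (cases "facets F \<inter> I = {}")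
        case True
        then have "Poly_Mapping.lookup x e = 0" if "e \<in> I" for e using lookup_square_boundary[OF F(2), of e] F that by auto
        then show ?thesis using nullB[OF F(2) True] by (simp add: P_def F)
      next
        case False
        then obtain e where e: "e \<in> I" "e \<in> facets F" by auto
        have "Poly_Mapping.lookup x e' = 0" if "e' \<in> I" "e' \<noteq> e" for e'
          using lookup_square_boundary[OF F(2), of e'] sep2[OF F(2), of e e'] F that e by (auto simp: I_def)
        then have "(\<Sum>e'\<in>I. Poly_Mapping.lookup x e' *\<^sub>R z e') = Poly_Mapping.lookup x e *\<^sub>R z e"
          using e(1) finI by (subst sum.remove[of I e]) auto
        then show ?thesis using zB[OF F(2) e(2,1)] by (simp add: P_def F)
      qed
    qed
    then show "y - (\<Sum>e\<in>I. Poly_Mapping.lookup y e *\<^sub>R z e) \<in> boundaries Q 1" by (simp add: P_def B_def)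
  qed
  then show ?thesis by (simp add: Q_def I_def)
qed

section \<open>Complexes in which every square without isolated edges is null-homologous\<close>

definition square_at :: "face \<Rightarrow> nat \<Rightarrow> face" where
  "square_at e j = (insert j (fst e), snd e - {j})"

definition directions :: "nat \<Rightarrow> face \<Rightarrow> nat set" where
  "directions n f = {..<n} - fst f"

definition flip :: "nat \<Rightarrow> nat set \<Rightarrow> nat set" where
  "flip k v = (if k \<in> v then v - {k} else insert k v)"

definition shift :: "face \<Rightarrow> nat \<Rightarrow> face" where
  "shift f k = (fst f, flip k (snd f))"

definition edge_degree :: "nat \<Rightarrow> face set \<Rightarrow> face \<Rightarrow> nat" where
  "edge_degree n W e = card {j \<in> directions n e. square_at e j \<in> W}"

text \<open>
  The constant has to be so small that two given edges are both sparse with probability less than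
  \<open>2\<^sup>-\<^sup>n\<close> by an exponential factor, and that \<open>8/1000 < 1/50\<close>, the constant in
  \<open>rich_in_double_shifts\<close>.
\<close>

definition sparse_edge :: "nat \<Rightarrow> face set \<Rightarrow> face \<Rightarrow> bool" where
  "sparse_edge n W e \<longleftrightarrow> real (edge_degree n W e) < real n / 1000"

text \<open>
  Four is the number of coordinates in which edges of two translates \<open>shift F k\<close> and \<open>shift F l\<close> of a
  square can differ: the two directions of the square together with \<open>k\<close> and \<open>l\<close>.
\<close>

definition near :: "face \<Rightarrow> face \<Rightarrow> bool" where
  "near e e' \<longleftrightarrow> card ((snd e - snd e') \<union> (snd e' - snd e)) \<le> 4"

text \<open>
  The four squares that do not contain \<open>e\<close> of the \<open>3\<close>-cube spanned by \<open>e\<close> and the directions \<open>j\<close>, \<open>k\<close>.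
  If they are present, the squares at \<open>e\<close> in the directions \<open>j\<close> and \<open>k\<close> are either both
  null-homologous or both not. The union in the second component inserts the direction of the
  edge \<open>e\<close>.
\<close>

definition link_block :: "face \<Rightarrow> nat \<Rightarrow> nat \<Rightarrow> face set" where
  "link_block e j k = {({j, k}, snd e - {j, k}), ({j, k}, fst e \<union> (snd e - {j, k})),
     shift (square_at e j) k, shift (square_at e k) j}"

definition isolates_sparse_edges :: "nat \<Rightarrow> face set \<Rightarrow> bool" where
  "isolates_sparse_edges n W \<longleftrightarrow> (\<forall>e\<in>cube_faces n 1. \<forall>e'\<in>cube_faces n 1.
     sparse_edge n W e \<and> sparse_edge n W e' \<and> near e e' \<longrightarrow> e = e')"

text \<open>
  Think of the graph on the directions at \<open>e\<close> that joins \<open>j\<close> and \<open>k\<close> when \<open>link_block e j k\<close> is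
  present: every partition into two large parts is crossed by an edge.
\<close>

definition mixes_links :: "nat \<Rightarrow> face set \<Rightarrow> bool" where
  "mixes_links n W \<longleftrightarrow> (\<forall>e\<in>cube_faces n 1. \<forall>A\<subseteq>directions n e.
     real n / 1000 \<le> real (card A) \<and> real n / 1000 \<le> real (card (directions n e - A)) \<longrightarrow>
     (\<exists>j\<in>A. \<exists>k\<in>directions n e - A. link_block e j k \<subseteq> W))"

text \<open>
  Requiring \<open>k < l\<close> makes the parametrisation of the doubly shifted squares injective.
\<close>

definition double_shifts :: "nat \<Rightarrow> face set \<Rightarrow> face \<Rightarrow> (nat \<times> nat) set" where
  "double_shifts n W F = {(k, l). k \<in> directions n F \<and> l \<in> directions n F \<and> k < l \<and> shift (shift F k) l \<in> W}"

text \<open>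
  There are about \<open>n\<^sup>2/2\<close> double shifts, and for \<open>p \<ge> 1/2\<close> at least half of them are expected to be
  present. Having at most \<open>n\<^sup>2/50\<close> of them has probability \<open>exp(-\<Omega>(n\<^sup>2))\<close>, small enough for a union
  bound over all squares.
\<close>

definition rich_in_double_shifts :: "nat \<Rightarrow> face set \<Rightarrow> bool" where
  "rich_in_double_shifts n W \<longleftrightarrow> (\<forall>F\<in>cube_faces n 2. real n ^ 2 / 50 < real (card (double_shifts n W F)))"

lemma directions_simps [simp]: "directions n (S, v) = {..<n} - S"
  by (simp add: directions_def)

lemma square_at_in_cube_faces:
  assumes "e \<in> cube_faces n 1" "j \<in> directions n e"
  shows "square_at e j \<in> cube_faces n 2"
  using assms by (auto simp: cube_faces_def directions_def square_at_def card_1_singleton_iff)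

lemma edge_facet_iff_square_at:
  assumes "e \<in> cube_faces n 1" "F \<in> cube_faces n 2"
  shows "e \<in> facets F \<longleftrightarrow> (\<exists>j\<in>directions n e. F = square_at e j)"
proof -
  obtain i v where "e = ({i}, v)" using cube_face_1E[OF assms(1)] by metis
  then show ?thesis using edge_facet_iff[of i v n F] assms by (auto simp: square_at_def insert_commute)
qed

lemma shift_in_cube_faces:
  "F \<in> cube_faces n d \<Longrightarrow> k \<in> directions n F \<Longrightarrow> shift F k \<in> cube_faces n d"
  by (auto simp: cube_faces_def shift_def directions_def flip_def)

lemma fst_shift [simp]: "fst (shift F k) = fst F" by (simp add: shift_def)

lemma directions_shift [simp]: "directions n (shift F k) = directions n F" by (simp add: directions_def)

lemma link_cube_facets:
  assumes e: "e \<in> cube_faces n 1" and jk: "j \<in> directions n e" "k \<in> directions n e" "j \<noteq> k"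
  obtains C where "C \<in> cube_faces n 3"
    "facets C = insert (square_at e j) (insert (square_at e k) (link_block e j k))"
proof -
  obtain i v where ei: "e = ({i}, v)" "i < n" "v \<subseteq> {..<n}" "i \<notin> v" using cube_face_1E[OF e] by metis
  define C where "C = ({i, j, k}, v - {j, k})"
  have jk': "j < n" "k < n" "j \<noteq> i" "k \<noteq> i" using jk ei by auto
  have "C \<in> cube_faces n 3" unfolding C_def cube_faces_iff using ei jk' jk(3) by auto
  moreover have "facets C = insert (square_at e j) (insert (square_at e k) (link_block e j k))"
  proof -
    define w where "w = v - {j, k}"
    have j: "{({i, j}, v - {j}), ({i, j}, flip k (v - {j}))} = {({i, j}, w), ({i, j}, insert k w)}"
      using jk(3) by (auto simp: w_def flip_def)
    have k: "{({i, k}, v - {k}), ({i, k}, flip j (v - {k}))} = {({i, k}, w), ({i, k}, insert j w)}"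
      using jk(3) by (auto simp: w_def flip_def)
    have "facets C = {({j, k}, w), ({j, k}, insert i w)} \<union> {({i, k}, w), ({i, k}, insert j w)} \<union>
       {({i, j}, w), ({i, j}, insert k w)}"
      unfolding C_def w_def using jk' jk(3) by (subst facets_cube) auto
    also have "\<dots> = {({j, k}, w), ({j, k}, insert i w)} \<union> {({i, k}, v - {k}), ({i, k}, flip j (v - {k}))} \<union>
       {({i, j}, v - {j}), ({i, j}, flip k (v - {j}))}" unfolding j k by simp
    also have "\<dots> = insert (square_at e j) (insert (square_at e k) (link_block e j k))"
      unfolding link_block_def square_at_def shift_def ei w_def by (simp add: insert_commute)
    finally show ?thesis .
  qed
  ultimately show ?thesis using that by blast
qed

lemma shift_cube_facets:
  assumes F: "F \<in> cube_faces n 2" and k: "k \<in> directions n F"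
  obtains C where "C \<in> cube_faces n 3"
    "facets C = insert F (insert (shift F k) ((\<lambda>e. square_at e k) ` facets F))"
proof -
  obtain a b v where Fe: "F = ({a, b}, v)" "a < b" "b < n" "v \<subseteq> {..<n}" "a \<notin> v" "b \<notin> v"
    using cube_face_2E[OF F] by metis
  have k': "k < n" "k \<noteq> a" "k \<noteq> b" using k Fe by auto
  define w where "w = v - {k}"
  define C where "C = ({a, b, k}, w)"
  have "C \<in> cube_faces n 3" unfolding C_def cube_faces_iff w_def using Fe k' by auto
  moreover have "facets C = insert F (insert (shift F k) ((\<lambda>e. square_at e k) ` facets F))"
  proof -
    have 1: "{F, shift F k} = {({a, b}, w), ({a, b}, insert k w)}"
      by (auto simp: Fe shift_def flip_def w_def)
    have "insert b v - {k} = insert b w" "insert a v - {k} = insert a w" using k' by (auto simp: w_def)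
    then have 2: "(\<lambda>e. square_at e k) ` facets F = {({b, k}, w), ({b, k}, insert a w), ({a, k}, w), ({a, k}, insert b w)}"
      using Fe(2) unfolding Fe(1) by (subst facets_square) (auto simp: square_at_def insert_commute w_def)
    have "facets C = {({b, k}, w), ({b, k}, insert a w), ({a, k}, w), ({a, k}, insert b w),
     ({a, b}, w), ({a, b}, insert k w)}" unfolding C_def by (intro facets_cube) (use Fe k' in auto)
    also have "\<dots> = {F, shift F k} \<union> (\<lambda>e. square_at e k) ` facets F" unfolding 1 2 by auto
    finally show ?thesis by simp
  qed
  ultimately show ?thesis using that by blast
qed

lemma near_in_cube:
  assumes C: "C \<in> cube_faces n 3" and "F \<in> facets C" "G \<in> facets C" "e \<in> facets F" "e' \<in> facets G"
  shows "near e e'"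
proof -
  obtain T w where Tw: "C = (T, w)" by (cases C)
  with C have T: "finite T" "card T = 3" by (auto simp: cube_faces_iff intro: finite_subset)
  have "w \<subseteq> snd x \<and> snd x \<subseteq> w \<union> T" if "x \<in> facets H" "H \<in> facets C" for x H
    using that by (auto simp: facets_def Tw)
  then have "(snd e - snd e') \<union> (snd e' - snd e) \<subseteq> T" using assms by blast
  then have "card ((snd e - snd e') \<union> (snd e' - snd e)) \<le> 3" using card_mono[OF T(1)] T(2) by metis
  then show ?thesis by (simp add: near_def)
qed

lemma square_in_cube:
  assumes "F \<in> cube_faces n 2" "n \<ge> 3"
  obtains C where "C \<in> cube_faces n 3" "F \<in> facets C"
proof -
  obtain S v where F: "F = (S, v)" by (cases F)
  have S: "finite S" "card S = 2" using assms F by (auto simp: cube_faces_iff intro: finite_subset)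
  have "\<not> {..<n} \<subseteq> S" using card_mono[OF S(1), of "{..<n}"] S(2) assms(2) by auto
  then obtain k where "k \<in> directions n F" by (auto simp: F)
  then show ?thesis using shift_cube_facets[OF assms(1)] that by (metis insertI1)
qed

locale robust_complex =
  fixes n :: nat and W :: "face set"
  assumes W: "W \<subseteq> cube_faces n 2" and n: "n \<ge> 1000"
    and sparse: "isolates_sparse_edges n W" and mixing: "mixes_links n W"
    and rich: "rich_in_double_shifts n W"
begin

lemma sparse_near_eq:
  "e \<in> cube_faces n 1 \<Longrightarrow> e' \<in> cube_faces n 1 \<Longrightarrow> sparse_edge n W e \<Longrightarrow> sparse_edge n W e' \<Longrightarrow> near e e' \<Longrightarrow> e = e'"
  using sparse unfolding isolates_sparse_edges_def by blast

lemma edges_of_square: "F \<in> cube_faces n 2 \<Longrightarrow> e \<in> facets F \<Longrightarrow> e \<in> cube_faces n 1"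
  using facets_in_cube_faces[of F n 1] by (simp add: numeral_2_eq_2)

lemma facets_of_cube: "C \<in> cube_faces n 3 \<Longrightarrow> F \<in> facets C \<Longrightarrow> F \<in> cube_faces n 2"
  using facets_in_cube_faces[of C n 2] by (simp add: numeral_2_eq_2 numeral_3_eq_3)

text \<open>
  In the application, \<open>N\<close> is the set of null-homologous squares of the cube.
\<close>

context
  fixes N assumes WN: "W \<subseteq> N" and closed: "cube_closed n N"
begin

lemma cube_closedD: "C \<in> cube_faces n 3 \<Longrightarrow> F \<in> facets C \<Longrightarrow> facets C - {F} \<subseteq> N \<Longrightarrow> F \<in> N"
  using closed unfolding cube_closed_def by blast

text \<open>
  The null directions at \<open>e\<close> contain the many directions of present squares, and no pair of a
  null and a non-null direction is joined. As every partition into two large parts is crossed, the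
  non-null directions are few.
\<close>

lemma few_directions_missing:
  assumes e: "e \<in> cube_faces n 1" and "\<not> sparse_edge n W e"
  shows "real (card {k \<in> directions n e. square_at e k \<notin> N}) < real n / 1000"
proof (rule ccontr)
  assume contra: "\<not> ?thesis"
  define Z where "Z = {k \<in> directions n e. square_at e k \<in> N}"
  have fin: "finite (directions n e)" by (simp add: directions_def)
  have "edge_degree n W e \<le> card Z"
    unfolding edge_degree_def Z_def using WN fin by (intro card_mono) auto
  then have 1: "real n / 1000 \<le> real (card Z)" using assms(2) unfolding sparse_edge_def by linarith
  have "directions n e - Z = {k \<in> directions n e. square_at e k \<notin> N}" by (auto simp: Z_def)
  then have 2: "real n / 1000 \<le> real (card (directions n e - Z))" using contra by simp
  have Zd: "Z \<subseteq> directions n e" by (auto simp: Z_def)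
  obtain j k where jk: "j \<in> Z" "k \<in> directions n e - Z" "link_block e j k \<subseteq> W"
    using mixing e Zd 1 2 unfolding mixes_links_def by blast
  then have "j \<in> directions n e" "k \<in> directions n e" "j \<noteq> k" using Zd by auto
  from link_cube_facets[OF e this] obtain C where C: "C \<in> cube_faces n 3"
    "facets C = insert (square_at e j) (insert (square_at e k) (link_block e j k))" by metis
  have "square_at e k \<in> N" by (rule cube_closedD[OF C(1)]) (use C jk WN in \<open>auto simp: Z_def\<close>)
  then show False using jk by (simp add: Z_def)
qed

text \<open>
  In the \<open>3\<close>-cube between \<open>F\<close> and its translate, the four lateral squares are squares at the edges of
  \<open>F\<close>, so for most directions they are null-homologous. In these directions \<open>F\<close> and its translate
  are null-homologous together or not at all.
\<close>

lemma few_shifts_null: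
  assumes F: "F \<in> cube_faces n 2" "F \<notin> N" and dense: "\<And>e. e \<in> facets F \<Longrightarrow> \<not> sparse_edge n W e"
  shows "real (card {k \<in> directions n F. shift F k \<in> N}) \<le> 4 * (real n / 1000)"
proof -
  define M where "M e = {k \<in> directions n e. square_at e k \<notin> N}" for e
  have finM: "finite (M e)" for e by (simp add: M_def directions_def)
  have fin: "finite (facets F)" using F(1) by (rule finite_facets)
  have "{k \<in> directions n F. shift F k \<in> N} \<subseteq> (\<Union>e\<in>facets F. M e)"
  proof
    fix k assume "k \<in> {k \<in> directions n F. shift F k \<in> N}"
    then have k: "k \<in> directions n F" "shift F k \<in> N" by auto
    from shift_cube_facets[OF F(1) k(1)] obtain C where C: "C \<in> cube_faces n 3"
      "facets C = insert F (insert (shift F k) ((\<lambda>e. square_at e k) ` facets F))" by metis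
    have "\<not> facets C - {F} \<subseteq> N" using cube_closedD[OF C(1), of F] F(2) C(2) by blast
    then obtain H where "H \<in> facets C" "H \<noteq> F" "H \<notin> N" by blast
    then have "H \<in> (\<lambda>e. square_at e k) ` facets F" using C(2) k(2) by blast
    then obtain e where e: "e \<in> facets F" "square_at e k \<notin> N" using \<open>H \<notin> N\<close> by blast
    have "k \<in> directions n e" using k(1) e(1) by (auto simp: directions_def facets_def split: prod.splits)
    then show "k \<in> (\<Union>e\<in>facets F. M e)" using e by (auto simp: M_def)
  qed
  then have "card {k \<in> directions n F. shift F k \<in> N} \<le> card (\<Union>e\<in>facets F. M e)"
    by (intro card_mono) (use fin finM in auto)
  also have "\<dots> \<le> (\<Sum>e\<in>facets F. card (M e))" by (rule card_UN_le[OF fin])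
  finally have "real (card {k \<in> directions n F. shift F k \<in> N}) \<le> (\<Sum>e\<in>facets F. real (card (M e)))"
    by (metis of_nat_le_iff of_nat_sum)
  also have "\<dots> \<le> (\<Sum>e\<in>facets F. real n / 1000)"
    using few_directions_missing edges_of_square[OF F(1)] dense unfolding M_def by (intro sum_mono less_imp_le) auto
  also have "\<dots> = real (card (facets F)) * (real n / 1000)" by simp
  also have "\<dots> \<le> 4 * (real n / 1000)"
  proof (rule mult_right_mono)
    obtain a b v where "F = ({a, b}, v)" "a < b" using cube_face_2E[OF F(1)] by metis
    then show "real (card (facets F)) \<le> 4" by (auto simp: facets_square card_insert_if)
  qed simp
  finally show ?thesis .
qed

text \<open>
  Two translates with sparse edges would yield two sparse edges near to each other.
\<close>

lemma shifts_with_sparse_edges: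
  assumes F: "F \<in> cube_faces n 2"
  shows "card {k \<in> directions n F. \<exists>e\<in>facets (shift F k). sparse_edge n W e} \<le> 1"
    (is "card ?A \<le> 1")
proof -
  have "k = k'" if k: "k \<in> directions n F" "e \<in> facets (shift F k)" "sparse_edge n W e"
    and k': "k' \<in> directions n F" "e' \<in> facets (shift F k')" "sparse_edge n W e'" for k k' e e'
  proof (rule ccontr)
    assume ne: "k \<noteq> k'"
    obtain a b v where Fe: "F = ({a, b}, v)" using cube_face_2E[OF F] by metis
    have kk: "k \<notin> {a, b}" "k' \<notin> {a, b}" using k k' Fe by auto
    have s: "snd e - {a, b} = flip k v - {a, b}" "snd e' - {a, b} = flip k' v - {a, b}"
      using k(2) k'(2) by (auto simp: Fe shift_def facets_def)
    have "(snd e - snd e') \<union> (snd e' - snd e) \<subseteq> {a, b, k, k'}"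
      using s by (auto simp: flip_def split: if_splits)
    then have "card ((snd e - snd e') \<union> (snd e' - snd e)) \<le> card {a, b, k, k'}" by (intro card_mono) auto
    also have "\<dots> \<le> 4" by (simp add: card_insert_if)
    finally have "near e e'" by (simp add: near_def)
    then have "e = e'"
      by (intro sparse_near_eq k(3) k'(3) edges_of_square[OF shift_in_cube_faces[OF F k(1)] k(2)]
        edges_of_square[OF shift_in_cube_faces[OF F k'(1)] k'(2)])
    then have "flip k v - {a, b} = flip k' v - {a, b}" using s by simp
    then have "k \<in> flip k v \<longleftrightarrow> k \<in> flip k' v" using kk by blast
    then show False using ne by (auto simp: flip_def split: if_splits)
  qed
  then have "\<forall>k\<in>?A. \<forall>k'\<in>?A. k = k'" by blast
  moreover have "finite ?A" by (simp add: directions_def)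
  ultimately show ?thesis by (simp only: One_nat_def card_le_Suc0_iff_eq)
qed

text \<open>
  Were \<open>F\<close> not null-homologous, then neither would be most of its translates, nor most translates of
  these. But present squares are null-homologous, so few double shifts of \<open>F\<close> could be present.
\<close>

lemma dense_square_null:
  assumes F: "F \<in> cube_faces n 2" and dense: "\<And>e. e \<in> facets F \<Longrightarrow> \<not> sparse_edge n W e"
  shows "F \<in> N"
proof (rule ccontr)
  assume FN: "F \<notin> N"
  define D where "D = directions n F"
  have finD: "finite D" and cD: "card D \<le> n" unfolding D_def directions_def
    using card_mono[of "{..<n}" "{..<n} - fst F"] by auto
  \<comment> \<open>the directions after which the argument cannot be repeated\<close>
  define B where "B = {k \<in> D. shift F k \<in> N} \<union> {k \<in> D. \<exists>e\<in>facets (shift F k). sparse_edge n W e}"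
  define L where "L k = {l \<in> D. shift (shift F k) l \<in> N}" for k
  have B: "real (card B) \<le> real n / 250 + 1"
  proof -
    have "card B \<le> card {k \<in> D. shift F k \<in> N} + card {k \<in> D. \<exists>e\<in>facets (shift F k). sparse_edge n W e}"
      unfolding B_def by (rule card_Un_le)
    then show ?thesis using few_shifts_null[OF F FN dense] shifts_with_sparse_edges[OF F] unfolding D_def by simp
  qed
  have L: "real (card (L k)) \<le> real n / 250" if "k \<in> D - B" for k
  proof -
    have k: "k \<in> directions n F" "shift F k \<notin> N" "\<And>e. e \<in> facets (shift F k) \<Longrightarrow> \<not> sparse_edge n W e"
      using that by (auto simp: D_def B_def)
    show ?thesis using few_shifts_null[OF shift_in_cube_faces[OF F k(1)] k(2,3)] by (simp add: L_def D_def)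
  qed
  have finB: "finite B" and finL: "finite (L k)" for k using finD by (auto simp: B_def L_def)
  have "double_shifts n W F \<subseteq> (B \<times> D) \<union> Sigma (D - B) L"
  proof
    fix x assume "x \<in> double_shifts n W F"
    then obtain k l where x: "x = (k, l)" "k \<in> D" "l \<in> D" "shift (shift F k) l \<in> W"
      by (auto simp: double_shifts_def D_def)
    then have "l \<in> L k" using WN by (auto simp: L_def)
    then show "x \<in> (B \<times> D) \<union> Sigma (D - B) L" using x by simp
  qed
  then have "card (double_shifts n W F) \<le> card ((B \<times> D) \<union> Sigma (D - B) L)"
    by (intro card_mono) (use finB finD finL in auto)
  also have "\<dots> \<le> card (B \<times> D) + card (Sigma (D - B) L)" by (rule card_Un_le)
  also have "\<dots> = card B * card D + (\<Sum>k\<in>D - B. card (L k))"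
    using finB finD finL by (simp add: card_cartesian_product)
  finally have "real (card (double_shifts n W F)) \<le> real (card B) * real (card D) + (\<Sum>k\<in>D - B. real (card (L k)))"
    by (simp flip: of_nat_add of_nat_mult of_nat_sum)
  also have "\<dots> \<le> (real n / 250 + 1) * real n + real (card (D - B)) * (real n / 250)"
    using B cD L by (intro add_mono mult_mono sum_bounded_above) auto
  also have "\<dots> \<le> (real n / 250 + 1) * real n + real n * (real n / 250)"
    using cD card_mono[OF finD, of "D - B"] by (intro add_mono mult_right_mono) auto
  also have "\<dots> \<le> real n ^ 2 / 50"
  proof -
    have "real n * 1000 \<le> real n * real n" using n by (intro mult_left_mono) auto
    then show ?thesis by (simp add: power2_eq_square algebra_simps)
  qed
  finally have "\<not> real n ^ 2 / 50 < real (card (double_shifts n W F))" by simp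
  then show False using rich F unfolding rich_in_double_shifts_def by blast
qed

text \<open>
  A sparse edge \<open>e\<close> of \<open>F\<close> lies in some present square \<open>G\<close>. In the \<open>3\<close>-cube of \<open>F\<close> and \<open>G\<close> the other
  four squares do not contain \<open>e\<close>, hence contain no sparse edge at all, and are null-homologous.
\<close>

lemma square_null:
  assumes F: "F \<in> cube_faces n 2" "facets F \<inter> isolated_edges n W = {}"
  shows "F \<in> N"
proof (cases "\<exists>e\<in>facets F. sparse_edge n W e")
  case False
  then show ?thesis by (intro dense_square_null[OF F(1)]) blast
next
  case True
  then obtain e where e: "e \<in> facets F" "sparse_edge n W e" by blast
  have e1: "e \<in> cube_faces n 1" using edges_of_square F e by blast
  have "e \<notin> isolated_edges n W" using e F(2) by blast
  then have "\<exists>G\<in>W. e \<in> facets G" using e1 by (simp add: isolated_edges_def)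
  then obtain G where G: "G \<in> W" "e \<in> facets G" by blast
  show ?thesis
  proof (cases "F = G")
    case True
    then show ?thesis using G WN by auto
  next
    case False
    obtain C where C: "C \<in> cube_faces n 3" "F \<in> facets C" "G \<in> facets C"
      "\<And>H. H \<in> facets C \<Longrightarrow> e \<in> facets H \<Longrightarrow> H = F \<or> H = G"
      using common_cube_of_squares[OF e1 F(1) e(1) subsetD[OF W G(1)] G(2) False] by metis
    have "H \<in> N" if H: "H \<in> facets C" "H \<noteq> F" for H
    proof (cases "H = G")
      case True
      then show ?thesis using G WN by auto
    next
      case False
      have H2: "H \<in> cube_faces n 2" using facets_of_cube C H by blast
      show ?thesis
      proof (rule dense_square_null[OF H2], rule notI)
        fix e' assume e': "e' \<in> facets H" "sparse_edge n W e'"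
        have "near e e'" using near_in_cube[OF C(1,2) H(1) e(1) e'(1)] .
        then have "e = e'" by (intro sparse_near_eq e1 e(2) e'(2) edges_of_square[OF H2 e'(1)])
        then show False using C(4)[OF H(1)] e' H False by blast
      qed
    qed
    then show ?thesis by (intro cube_closedD[OF C(1,2)]) auto
  qed
qed

end

lemma isolated_sparse: "e \<in> isolated_edges n W \<Longrightarrow> e \<in> cube_faces n 1 \<and> sparse_edge n W e"
proof -
  assume e: "e \<in> isolated_edges n W"
  then have e1: "e \<in> cube_faces n 1" by (simp add: isolated_edges_def)
  have "{j \<in> directions n e. square_at e j \<in> W} = {}"
  proof (intro equals0I)
    fix j assume "j \<in> {j \<in> directions n e. square_at e j \<in> W}"
    then have j: "j \<in> directions n e" "square_at e j \<in> W" by auto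
    then have "e \<in> facets (square_at e j)" using edge_facet_iff_square_at[OF e1 subsetD[OF W j(2)]] by blast
    then show False using e j(2) by (simp add: isolated_edges_def)
  qed
  then have "edge_degree n W e = 0" by (simp only: edge_degree_def card.empty)
  then show ?thesis using e1 n by (simp add: sparse_edge_def)
qed

theorem betti_eq_isolated: "betti (cube_skeleton n 1 \<union> W) 1 = card (isolated_edges n W)"
proof (rule betti_eq_card_isolated)
  show "n \<ge> 2" using n by simp
  show "W \<subseteq> cube_faces n 2" by (rule W)
  show "F \<in> N" if "W \<subseteq> N" "cube_closed n N" "F \<in> cube_faces n 2" "facets F \<inter> isolated_edges n W = {}" for N F
    using square_null that by blast
  show sep: "e = e'" if "C \<in> cube_faces n 3" "e \<in> isolated_edges n W" "e' \<in> isolated_edges n W"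
    "F \<in> facets C" "G \<in> facets C" "e \<in> facets F" "e' \<in> facets G" for C F G e e'
    using sparse_near_eq[OF _ _ _ _ near_in_cube[OF that(1,4,5,6,7)]]
      isolated_sparse[OF that(2)] isolated_sparse[OF that(3)] by simp
  show "e = e'" if "F \<in> cube_faces n 2" "e \<in> isolated_edges n W" "e' \<in> isolated_edges n W" "e \<in> facets F" "e' \<in> facets F" for F e e'
  proof -
    have "3 \<le> n" using n by simp
    from square_in_cube[OF that(1) this] obtain C where C: "C \<in> cube_faces n 3" "F \<in> facets C" by metis
    show ?thesis by (rule sep[OF C(1) that(2,3) C(2) C(2) that(4,5)])
  qed
qed

end

section \<open>Independent coin tosses\<close>

abbreviation coins :: "'a set \<Rightarrow> real \<Rightarrow> ('a \<Rightarrow> bool) pmf" where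
  "coins A p \<equiv> Pi_pmf A False (\<lambda>_. bernoulli_pmf p)"

lemma finite_set_pmf_coins: "finite A \<Longrightarrow> finite (set_pmf (coins A p))"
  by (rule finite_subset[OF set_Pi_pmf_subset']) (auto intro!: finite_PiE_dflt)

lemma prob_all_tails:
  assumes "finite A" "U \<subseteq> A" "0 \<le> p" "p \<le> 1"
  shows "measure_pmf.prob (coins A p) {\<omega>. \<forall>x\<in>U. \<not> \<omega> x} = (1 - p) ^ card U"
proof -
  have "{\<omega>. \<forall>x\<in>U. \<not> \<omega> x} = Pi A (\<lambda>x. if x \<in> U then {False} else UNIV)"
    using assms(2) by (auto simp: Pi_def split: if_splits)
  then have "measure_pmf.prob (coins A p) {\<omega>. \<forall>x\<in>U. \<not> \<omega> x} =
    (\<Prod>x\<in>A. measure_pmf.prob (bernoulli_pmf p) (if x \<in> U then {False} else UNIV))"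
    by (simp only: measure_Pi_pmf_Pi[OF assms(1)])
  also have "\<dots> = (\<Prod>x\<in>A. if x \<in> U then 1 - p else 1)"
    using assms(3,4) by (intro prod.cong) (auto simp: measure_pmf_single)
  also have "\<dots> = (1 - p) ^ card U"
    using assms(1,2) by (simp add: prod.If_cases Int_absorb1)
  finally show ?thesis .
qed

lemma prob_all_heads:
  assumes "finite A" "U \<subseteq> A" "0 \<le> p" "p \<le> 1"
  shows "measure_pmf.prob (coins A p) {\<omega>. \<forall>x\<in>U. \<omega> x} = p ^ card U"
proof -
  have "{\<omega>. \<forall>x\<in>U. \<omega> x} = Pi A (\<lambda>x. if x \<in> U then {True} else UNIV)"
    using assms(2) by (auto simp: Pi_def split: if_splits)
  then have "measure_pmf.prob (coins A p) {\<omega>. \<forall>x\<in>U. \<omega> x} =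
    (\<Prod>x\<in>A. measure_pmf.prob (bernoulli_pmf p) (if x \<in> U then {True} else UNIV))"
    by (simp only: measure_Pi_pmf_Pi[OF assms(1)])
  also have "\<dots> = (\<Prod>x\<in>A. if x \<in> U then p else 1)"
    using assms(3,4) by (intro prod.cong) (auto simp: measure_pmf_single)
  also have "\<dots> = p ^ card U"
    using assms(1,2) by (simp add: prod.If_cases Int_absorb1)
  finally show ?thesis .
qed

text \<open>
  Chernoff's bound: Markov's inequality for the random variable \<open>t ^ h\<close>, where \<open>h\<close> is the number
  of heads in \<open>U\<close>. As \<open>t \<le> 1\<close>, among all \<open>p \<ge> 1/2\<close> the mean of this variable is largest for a fair
  coin.
\<close>

lemma prob_few_heads:
  assumes A: "finite A" "U \<subseteq> A" and p: "1 / 2 \<le> p" "p \<le> 1" and t: "0 < t" "t \<le> 1"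
  shows "measure_pmf.prob (coins A p) {\<omega>. real (card {x \<in> U. \<omega> x}) \<le> s} \<le>
    t powr (- s) * ((1 + t) / 2) ^ card U" (is "?P \<le> _")
proof -
  have finU: "finite U" using A finite_subset by blast
  define f where "f x b = (if x \<in> U \<and> b then t else 1)" for x b
  have prod_f: "(\<Prod>x\<in>A. f x (\<omega> x)) = t ^ card {x \<in> U. \<omega> x}" for \<omega>
  proof -
    have "(\<Prod>x\<in>A. f x (\<omega> x)) = (\<Prod>x\<in>A. if x \<in> {x \<in> U. \<omega> x} then t else 1)"
      by (intro prod.cong) (auto simp: f_def)
    also have "\<dots> = t ^ card {x \<in> U. \<omega> x}"
      using A by (simp add: prod.If_cases Int_absorb1 subset_iff Int_def) (metis (mono_tags, lifting) Collect_cong subsetD)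
    finally show ?thesis .
  qed
  have int: "integrable (measure_pmf (coins A p)) g" for g :: "_ \<Rightarrow> real"
    by (rule integrable_measure_pmf_finite[OF finite_set_pmf_coins[OF A(1)]])
  have "?P = measure_pmf.expectation (coins A p) (indicator {\<omega>. real (card {x \<in> U. \<omega> x}) \<le> s})" by simp
  also have "\<dots> \<le> measure_pmf.expectation (coins A p) (\<lambda>\<omega>. t powr (- s) * (\<Prod>x\<in>A. f x (\<omega> x)))"
  proof (rule integral_mono[OF int int])
    fix \<omega>
    have "1 \<le> t powr (- s) * t ^ card {x \<in> U. \<omega> x}" if "real (card {x \<in> U. \<omega> x}) \<le> s"
    proof -
      have "1 \<le> t powr (real (card {x \<in> U. \<omega> x}) - s)" using that t
        using powr_mono_both'[of "- (s - real (card {x \<in> U. \<omega> x}))" 0 t 1]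
        by (metis diff_ge_0_iff_ge le_iff_diff_le_0 powr_mono' powr_zero_eq_one less_imp_le not_one_le_zero less_irrefl)
      also have "\<dots> = t powr (- s) * t ^ card {x \<in> U. \<omega> x}"
        using t by (simp add: powr_diff powr_minus powr_realpow field_simps)
      finally show ?thesis .
    qed
    then show "indicator {\<omega>. real (card {x \<in> U. \<omega> x}) \<le> s} \<omega> \<le> t powr (- s) * (\<Prod>x\<in>A. f x (\<omega> x))"
      using t unfolding prod_f by (auto simp: indicator_def)
  qed
  also have "\<dots> = t powr (- s) * (\<Prod>x\<in>A. measure_pmf.expectation (bernoulli_pmf p) (f x))"
    using t by (subst integral_mult_right_zero, subst expectation_prod_Pi_pmf)
      (auto simp: A f_def intro!: integrable_measure_pmf_finite)
  also have "(\<Prod>x\<in>A. measure_pmf.expectation (bernoulli_pmf p) (f x)) = (\<Prod>x\<in>A. if x \<in> U then p * t + (1 - p) else 1)"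
    using p by (intro prod.cong) (auto simp: f_def algebra_simps)
  also have "\<dots> = (p * t + (1 - p)) ^ card U"
    using A by (simp add: prod.If_cases Int_absorb1)
  also have "\<dots> \<le> ((1 + t) / 2) ^ card U"
  proof (rule power_mono)
    have "(1 - t) * (1 / 2) \<le> (1 - t) * p" using p t by (intro mult_left_mono) auto
    then show "p * t + (1 - p) \<le> (1 + t) / 2" by (simp add: field_simps)
    show "0 \<le> p * t + (1 - p)" using p t by auto
  qed
  finally show ?thesis using t by (simp add: mult_left_mono)
qed

text \<open>
  The events that the blocks consist of heads are independent. Instead of independence, the proof
  uses inclusion and exclusion: expanding the product of the complementary indicators leaves only
  probabilities that a union of disjoint blocks consists of heads.
\<close>

lemma prob_no_block_all_heads:
  assumes A: "finite A" and J: "finite J" and p: "0 \<le> p" "p \<le> 1"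
    and sub: "\<And>j. j \<in> J \<Longrightarrow> b j \<subseteq> A" and disj: "disjoint_family_on b J"
  shows "measure_pmf.prob (coins A p) {\<omega>. \<forall>j\<in>J. \<exists>x\<in>b j. \<not> \<omega> x} = (\<Prod>j\<in>J. 1 - p ^ card (b j))"
proof -
  have int: "integrable (measure_pmf (coins A p)) g" for g :: "_ \<Rightarrow> real"
    by (rule integrable_measure_pmf_finite[OF finite_set_pmf_coins[OF A]])
  have ind: "indicator {\<omega>. \<forall>j\<in>J. \<exists>x\<in>b j. \<not> \<omega> x} \<omega> =
     (\<Sum>X\<in>Pow J. (-1) ^ card X * indicator {\<omega>. \<forall>x\<in>(\<Union>j\<in>X. b j). \<omega> x} \<omega> :: real)" for \<omega>
  proof -
    have pr: "(\<Prod>j\<in>X. indicator {\<omega>. \<forall>x\<in>b j. \<omega> x} \<omega>) = (indicator {\<omega>. \<forall>x\<in>(\<Union>j\<in>X. b j). \<omega> x} \<omega> :: real)"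
      if "finite X" for X using that by (induction X rule: finite_induct) (auto simp: indicator_def)
    have "(indicator {\<omega>. \<forall>j\<in>J. \<exists>x\<in>b j. \<not> \<omega> x} \<omega> :: real) = (\<Prod>j\<in>J. 1 - indicator {\<omega>. \<forall>x\<in>b j. \<omega> x} \<omega>)"
      using J by (induction J rule: finite_induct) (auto simp: indicator_def)
    also have "\<dots> = (\<Sum>X\<in>Pow J. (-1) ^ card X * (\<Prod>j\<in>X. indicator {\<omega>. \<forall>x\<in>b j. \<omega> x} \<omega>))"
      using prod_diff_conv_sum[OF J, of "\<lambda>_. 1::real"] by simp
    also have "\<dots> = (\<Sum>X\<in>Pow J. (-1) ^ card X * indicator {\<omega>. \<forall>x\<in>(\<Union>j\<in>X. b j). \<omega> x} \<omega>)"
      using J by (intro sum.cong refl) (simp add: pr finite_subset)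
    finally show ?thesis .
  qed
  have "measure_pmf.prob (coins A p) {\<omega>. \<forall>j\<in>J. \<exists>x\<in>b j. \<not> \<omega> x} =
      measure_pmf.expectation (coins A p) (indicator {\<omega>. \<forall>j\<in>J. \<exists>x\<in>b j. \<not> \<omega> x})" by simp
  also have "\<dots> = measure_pmf.expectation (coins A p) (\<lambda>\<omega>. \<Sum>X\<in>Pow J. (-1) ^ card X * indicator {\<omega>. \<forall>x\<in>(\<Union>j\<in>X. b j). \<omega> x} \<omega>)"
    by (rule arg_cong[of _ _ "measure_pmf.expectation _"]) (use ind in auto)
  also have "\<dots> = (\<Sum>X\<in>Pow J. (-1) ^ card X * measure_pmf.prob (coins A p) {\<omega>. \<forall>x\<in>(\<Union>j\<in>X. b j). \<omega> x})"
    by (subst Bochner_Integration.integral_sum[OF int]) simp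
  also have "\<dots> = (\<Sum>X\<in>Pow J. (-1) ^ card X * (\<Prod>j\<in>X. p ^ card (b j)))"
  proof (intro sum.cong refl arg_cong2[of _ _ _ _ "(*)"])
    fix X assume "X \<in> Pow J"
    then have X: "X \<subseteq> J" "finite X" using J finite_subset by auto
    have fb: "finite (b j)" if "j \<in> X" for j using sub X that A finite_subset by blast
    have "card (\<Union>j\<in>X. b j) = (\<Sum>j\<in>X. card (b j))"
      using X disj fb by (intro card_UN_disjoint) (auto simp: disjoint_family_on_def)
    moreover have "(\<Union>j\<in>X. b j) \<subseteq> A" using sub X by blast
    ultimately show "measure_pmf.prob (coins A p) {\<omega>. \<forall>x\<in>(\<Union>j\<in>X. b j). \<omega> x} = (\<Prod>j\<in>X. p ^ card (b j))"
      using prob_all_heads[OF A _ p, of "\<Union>j\<in>X. b j"] by (simp only: power_sum)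
  qed
  also have "\<dots> = (\<Prod>j\<in>J. 1 - p ^ card (b j))"
    using prod_diff_conv_sum[OF J, of "\<lambda>_. 1::real"] by simp
  finally show ?thesis .
qed

lemma prob_UN_bound:
  assumes "finite I" "E \<subseteq> (\<Union>i\<in>I. F i)" "\<And>i. i \<in> I \<Longrightarrow> measure_pmf.prob M (F i) \<le> q" "real (card I) \<le> m" "0 \<le> q"
  shows "measure_pmf.prob M E \<le> m * q"
proof -
  have "measure_pmf.prob M E \<le> measure_pmf.prob M (\<Union>i\<in>I. F i)"
    by (rule measure_pmf.finite_measure_mono[OF assms(2)]) simp
  also have "\<dots> \<le> (\<Sum>i\<in>I. measure_pmf.prob M (F i))"
    by (rule measure_pmf.finite_measure_subadditive_finite[OF assms(1)]) auto
  also have "\<dots> \<le> real (card I) * q" using assms(3) by (rule sum_bounded_above)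
  also have "\<dots> \<le> m * q" using assms(4,5) by (rule mult_right_mono)
  finally show ?thesis .
qed

section \<open>Robustness with high probability\<close>

definition star :: "nat \<Rightarrow> face \<Rightarrow> face set" where
  "star n e = {F \<in> cube_faces n 2. e \<in> facets F}"

definition present :: "nat \<Rightarrow> (face \<Rightarrow> bool) \<Rightarrow> face set" where
  "present n \<omega> = {F \<in> cube_faces n 2. \<omega> F}"

lemma present_subset: "present n \<omega> \<subseteq> cube_faces n 2"
  by (auto simp: present_def)

lemma star_eq: "e \<in> cube_faces n 1 \<Longrightarrow> star n e = square_at e ` directions n e"
  using edge_facet_iff_square_at[of e n] square_at_in_cube_faces[of e n] unfolding star_def by blast

lemma finite_directions [simp]: "finite (directions n e)"
  by (simp add: directions_def)

lemma card_directions: "f \<in> cube_faces n d \<Longrightarrow> card (directions n f) = n - d"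
  by (auto simp: cube_faces_def directions_def card_Diff_subset finite_subset)

lemma inj_square_at: "inj_on (square_at e) (directions n e)"
  by (auto simp: inj_on_def square_at_def directions_def)

lemma finite_star: "finite (star n e)"
  by (simp add: star_def finite_cube_faces)

lemma card_star: "e \<in> cube_faces n 1 \<Longrightarrow> card (star n e) = n - 1"
  by (simp add: star_eq card_image[OF inj_square_at] card_directions)

text \<open>
  Two different squares through \<open>e\<close> have no other edge in common. Hence degrees of different edges are almost independent.
\<close>

lemma card_star_Int:
  assumes "e \<in> cube_faces n 1" "e' \<in> cube_faces n 1" "e \<noteq> e'"
  shows "card (star n e \<inter> star n e') \<le> 1"
proof -
  have "F = G" if FG: "F \<in> star n e \<inter> star n e'" "G \<in> star n e \<inter> star n e'" for F G
  proof (rule ccontr)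
    assume ne: "F \<noteq> G"
    obtain i v where ei: "e = ({i}, v)" "i \<notin> v" using cube_face_1E[OF assms(1)] by metis
    obtain i' v' where ei': "e' = ({i'}, v')" "i' \<notin> v'" using cube_face_1E[OF assms(2)] by metis
    obtain j where j: "j \<noteq> i" "F = ({i, j}, v - {j})"
      using FG(1) star_eq[OF assms(1)] ei by (auto simp: square_at_def insert_commute)
    obtain k where k: "k \<noteq> i" "G = ({i, k}, v - {k})"
      using FG(2) star_eq[OF assms(1)] ei by (auto simp: square_at_def insert_commute)
    obtain j' where j': "j' \<noteq> i'" "F = ({i', j'}, v' - {j'})"
      using FG(1) star_eq[OF assms(2)] ei' by (auto simp: square_at_def insert_commute)
    obtain k' where k': "k' \<noteq> i'" "G = ({i', k'}, v' - {k'})"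
      using FG(2) star_eq[OF assms(2)] ei' by (auto simp: square_at_def insert_commute)
    have jk: "j \<noteq> k" using ne j k by auto
    have sets: "{i, j} = {i', j'}" "{i, k} = {i', k'}" and v: "v - {j} = v' - {j'}" "v - {k} = v' - {k'}"
      using j j' k k' by auto
    have "i' = i \<and> j' = j \<and> k' = k" using sets jk j(1) k(1) by (auto simp: doubleton_eq_iff)
    then have "i' = i" "v = v'" using v jk by auto
    then show False using assms(3) ei ei' by simp
  qed
  then have "\<forall>F\<in>star n e \<inter> star n e'. \<forall>G\<in>star n e \<inter> star n e'. F = G" by blast
  moreover have "finite (star n e \<inter> star n e')" using finite_star by blast
  ultimately show ?thesis by (simp only: One_nat_def card_le_Suc0_iff_eq)
qed

lemma edge_degree_star:
  assumes "e \<in> cube_faces n 1"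
  shows "edge_degree n (present n \<omega>) e = card {F \<in> star n e. \<omega> F}"
proof -
  have "{F \<in> star n e. \<omega> F} = square_at e ` {j \<in> directions n e. square_at e j \<in> present n \<omega>}"
    using square_at_in_cube_faces[OF assms] by (auto simp: star_eq[OF assms] present_def)
  moreover have "inj_on (square_at e) {j \<in> directions n e. square_at e j \<in> present n \<omega>}"
    by (rule inj_on_subset[OF inj_square_at[of e n]]) auto
  ultimately show ?thesis by (simp add: edge_degree_def card_image)
qed

lemma card_cube_faces_le: "real (card (cube_faces n k)) \<le> 4 ^ n"
proof -
  have "card (cube_faces n k) \<le> card (Pow {..<n} \<times> Pow {..<n})"
    by (rule card_mono) (auto simp: cube_faces_def)
  also have "\<dots> = 4 ^ n" by (simp add: card_cartesian_product card_Pow flip: power_mult_distrib)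
  finally show ?thesis by (metis of_nat_le_iff of_nat_numeral of_nat_power)
qed

lemma card_edges_le: "card (cube_faces n 1) \<le> n * 2 ^ n"
proof -
  have "card (cube_faces n 1) \<le> card ((\<lambda>i. {i}) ` {..<n} \<times> Pow {..<n})"
    by (rule card_mono) (auto simp: cube_faces_def card_1_singleton_iff)
  also have "\<dots> = n * 2 ^ n" by (simp add: card_cartesian_product card_Pow card_image)
  finally show ?thesis .
qed

text \<open>
  An edge near \<open>e\<close> is determined by its direction and the set of at most four coordinates in which its
  base point differs from that of \<open>e\<close>.
\<close>

lemma card_near_le:
  assumes "n \<ge> 1" and e: "e \<in> cube_faces n 1"
  shows "card {e' \<in> cube_faces n 1. near e e'} \<le> n * (5 * n ^ 4)"
proof -
  define sd where "sd v = (snd e - v) \<union> (v - snd e)" for v :: "nat set"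
  have small: "card {X. X \<subseteq> {..<n} \<and> card X \<le> 4} \<le> 5 * n ^ 4"
  proof -
    have "{X. X \<subseteq> {..<n} \<and> card X \<le> 4} = (\<Union>d\<in>{..4}. {X. X \<subseteq> {..<n} \<and> card X = d})" by auto
    then have "card {X. X \<subseteq> {..<n} \<and> card X \<le> 4} \<le> (\<Sum>d\<in>{..4}. card {X. X \<subseteq> {..<n} \<and> card X = d})"
      using card_UN_le[of "{..4::nat}"] by auto
    also have "\<dots> = (\<Sum>d\<in>{..4}. n choose d)" by (simp add: n_subsets)
    also have "\<dots> \<le> (\<Sum>d\<in>{..4::nat}. n ^ 4)"
    proof (rule sum_mono)
      fix d :: nat assume d: "d \<in> {..4}"
      have "(n choose d) * 1 \<le> (n choose d) * fact d" by (intro mult_left_mono) auto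
      also have "\<dots> \<le> n ^ d" by (rule binomial_fact_pow)
      also have "\<dots> \<le> n ^ 4" using d assms by (intro power_increasing) auto
      finally show "n choose d \<le> n ^ 4" by simp
    qed
    finally show ?thesis by simp
  qed
    let ?h = "\<lambda>e'. (fst e', sd (snd e'))"
    have "inj_on ?h {e' \<in> cube_faces n 1. near e e'}"
    proof (rule inj_onI)
      fix x y assume "?h x = ?h y"
      then have "fst x = fst y" and s: "sd (snd x) = sd (snd y)" by auto
      moreover have "snd x = snd y" 
      proof -
        have "sd (sd v) = v" for v by (auto simp: sd_def)
        then show ?thesis using s by metis
      qed
      ultimately show "x = y" by (simp add: prod_eq_iff)
    qed
    moreover have "?h ` {e' \<in> cube_faces n 1. near e e'} \<subseteq> (\<lambda>i. {i}) ` {..<n} \<times> {X. X \<subseteq> {..<n} \<and> card X \<le> 4}"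
      using e by (auto simp: cube_faces_def card_1_singleton_iff near_def sd_def)
    ultimately have "card {e' \<in> cube_faces n 1. near e e'} \<le> card ((\<lambda>i. {i}) ` {..<n} \<times> {X. X \<subseteq> {..<n} \<and> card X \<le> 4})"
      by (rule card_inj_on_le) auto
    also have "\<dots> = n * card {X. X \<subseteq> {..<n} \<and> card X \<le> 4}" by (simp add: card_cartesian_product card_image)
    also have "\<dots> \<le> n * (5 * n ^ 4)" using small by simp
    finally show ?thesis .
qed

text \<open>
  Together the two edges lie in at least \<open>2n - 3\<close> squares, of which fewer than \<open>n/500\<close> are present if
  both are sparse. The choice \<open>t = 1/10\<close> in Chernoff's bound makes the base
  \<open>(11/20)\<^sup>2 \<sqdot> 10\<^bsup>1/500\<^esup>\<close> smaller than \<open>1/2\<close>.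
\<close>

lemma prob_sparse_pair:
  assumes p: "1 / 2 \<le> p" "p \<le> 1" and e: "e \<in> cube_faces n 1" "e' \<in> cube_faces n 1" "e \<noteq> e'"
  shows "measure_pmf.prob (coins (cube_faces n 2) p)
      {\<omega>. sparse_edge n (present n \<omega>) e \<and> sparse_edge n (present n \<omega>) e'} \<le>
    (1 / 10) powr (- (real n / 500)) * (11 / 20) ^ (2 * n - 3)"
proof -
  let ?U = "star n e \<union> star n e'"
  have fin: "finite ?U" using finite_star by blast
  have "card (star n e) + card (star n e') = card ?U + card (star n e \<inter> star n e')"
    by (rule card_Un_Int) (auto simp: finite_star)
  then have cU: "2 * n - 3 \<le> card ?U" using card_star e card_star_Int[OF e] by simp
  have "{\<omega>. sparse_edge n (present n \<omega>) e \<and> sparse_edge n (present n \<omega>) e'} \<subseteq>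
      {\<omega>. real (card {x \<in> ?U. \<omega> x}) \<le> real n / 500}"
  proof (rule Collect_mono, rule impI)
    fix \<omega> assume s: "sparse_edge n (present n \<omega>) e \<and> sparse_edge n (present n \<omega>) e'"
    have "card {x \<in> ?U. \<omega> x} \<le> card ({x \<in> star n e. \<omega> x} \<union> {x \<in> star n e'. \<omega> x})"
      by (rule card_mono) (auto simp: finite_star)
    also have "\<dots> \<le> card {x \<in> star n e. \<omega> x} + card {x \<in> star n e'. \<omega> x}" by (rule card_Un_le)
    finally show "real (card {x \<in> ?U. \<omega> x}) \<le> real n / 500"
      using s e by (simp add: sparse_edge_def edge_degree_star)
  qed
  then have "measure_pmf.prob (coins (cube_faces n 2) p)
      {\<omega>. sparse_edge n (present n \<omega>) e \<and> sparse_edge n (present n \<omega>) e'} \<le>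
    measure_pmf.prob (coins (cube_faces n 2) p) {\<omega>. real (card {x \<in> ?U. \<omega> x}) \<le> real n / 500}"
    by (rule measure_pmf.finite_measure_mono) simp
  also have "\<dots> \<le> (1 / 10) powr (- (real n / 500)) * ((1 + 1 / 10) / 2) ^ card ?U"
    by (rule prob_few_heads) (use p in \<open>auto simp: finite_cube_faces star_def\<close>)
  also have "\<dots> \<le> (1 / 10) powr (- (real n / 500)) * (11 / 20) ^ (2 * n - 3)"
    using cU by (intro mult_left_mono) (auto intro!: power_decreasing)
  finally show ?thesis .
qed

lemma prob_not_isolates_sparse_edges:
  assumes p: "1 / 2 \<le> p" "p \<le> 1" and n: "n \<ge> 1"
  shows "measure_pmf.prob (coins (cube_faces n 2) p) {\<omega>. \<not> isolates_sparse_edges n (present n \<omega>)} \<le>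
    (real n * 2 ^ n) * (5 * real n ^ 5) * ((1 / 10) powr (- (real n / 500)) * (11 / 20) ^ (2 * n - 3))"
proof (rule prob_UN_bound)
  let ?I = "Sigma (cube_faces n 1) (\<lambda>e. {e' \<in> cube_faces n 1. near e e'} - {e})"
  let ?F = "\<lambda>(e, e'). {\<omega>. sparse_edge n (present n \<omega>) e \<and> sparse_edge n (present n \<omega>) e'}"
  show "finite ?I" using finite_cube_faces by auto
  show "{\<omega>. \<not> isolates_sparse_edges n (present n \<omega>)} \<subseteq> (\<Union>i\<in>?I. ?F i)"
    unfolding isolates_sparse_edges_def by fastforce
  show "measure_pmf.prob (coins (cube_faces n 2) p) (?F i) \<le> (1 / 10) powr (- (real n / 500)) * (11 / 20) ^ (2 * n - 3)"
    if i: "i \<in> ?I" for i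
  proof -
    obtain e e' where "i = (e, e')" "e \<in> cube_faces n 1" "e' \<in> cube_faces n 1" "e \<noteq> e'" using i by blast
    then show ?thesis using prob_sparse_pair[OF p, of e n e'] by simp
  qed
  have "card ?I = (\<Sum>e\<in>cube_faces n 1. card ({e' \<in> cube_faces n 1. near e e'} - {e}))"
    using finite_cube_faces by (intro card_SigmaI) auto
  also have "\<dots> \<le> card (cube_faces n 1) * (n * (5 * n ^ 4))"
  proof (rule sum_bounded_above[where 'a = nat, simplified])
    fix e assume e: "e \<in> cube_faces n 1"
    have "card ({e' \<in> cube_faces n 1. near e e'} - {e}) \<le> card {e' \<in> cube_faces n 1. near e e'}"
      by (rule card_mono) (auto simp: finite_cube_faces)
    then show "card ({e' \<in> cube_faces n 1. near e e'} - {e}) \<le> n * (5 * n ^ 4)"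
      using card_near_le[OF n e] by linarith
  qed
  also have "\<dots> \<le> (n * 2 ^ n) * (n * (5 * n ^ 4))" using card_edges_le by (rule mult_right_mono) simp
  finally have "real (card ?I) \<le> real ((n * 2 ^ n) * (n * (5 * n ^ 4)))" by (simp only: of_nat_le_iff)
  then show "real (card ?I) \<le> (real n * 2 ^ n) * (5 * real n ^ 5)" by (simp add: power_Suc[symmetric] eval_nat_numeral mult_ac)
qed simp

lemma link_block_subset:
  assumes e: "e \<in> cube_faces n 1" and jk: "j \<in> directions n e" "k \<in> directions n e" "j \<noteq> k"
  shows "link_block e j k \<subseteq> cube_faces n 2" "card (link_block e j k) \<le> 4"
proof -
  obtain C where C: "C \<in> cube_faces n 3"
    "facets C = insert (square_at e j) (insert (square_at e k) (link_block e j k))"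
    using link_cube_facets[OF assms] by metis
  then show "link_block e j k \<subseteq> cube_faces n 2"
    using facets_in_cube_faces[of C n 2] by (auto simp: numeral_3_eq_3 numeral_2_eq_2)
  show "card (link_block e j k) \<le> 4" by (auto simp: link_block_def card_insert_if)
qed

text \<open>
  A square \<open>F\<close> of \<open>link_block e j k\<close> determines \<open>{j, k}\<close>: either \<open>F\<close> does not involve the direction
  of \<open>e\<close> and its directions are \<open>j\<close> and \<open>k\<close>, or its second direction is one of them and the other is the
  coordinate, apart from the directions of \<open>F\<close>, in which its base point differs from that of \<open>e\<close>. As \<open>j\<close> and \<open>k\<close> lie on different sides
  of the cut, this determines the pair.
\<close>

lemma link_blocks_disjoint:
  assumes e: "e \<in> cube_faces n 1" and A: "A \<subseteq> directions n e"
  shows "disjoint_family_on (\<lambda>(j, k). link_block e j k) (A \<times> (directions n e - A))"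
proof -
  obtain i v where ei: "e = ({i}, v)" "i < n" "v \<subseteq> {..<n}" "i \<notin> v" using cube_face_1E[OF e] by metis
  have flip_inj: "flip a x = flip b x \<longleftrightarrow> a = b" for a b :: nat and x
    by (auto simp: flip_def split: if_splits)
  have "(j, k) = (j', k')"
    if jk: "j \<in> A" "k \<in> directions n e" "k \<notin> A" and jk': "j' \<in> A" "k' \<in> directions n e" "k' \<notin> A"
      and F: "F \<in> link_block e j k" "F \<in> link_block e j' k'" for j k j' k' F
  proof -
    have ne: "j \<noteq> k" "j' \<noteq> k'" "j \<noteq> k'" "j' \<noteq> k" using jk jk' by auto
    have ni: "i \<noteq> j" "i \<noteq> k" "i \<noteq> j'" "i \<noteq> k'" using jk jk' A ei by auto
    have kinds: "i \<notin> fst F \<and> fst F = {j, k} \<or>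
        (\<exists>x y. x \<noteq> i \<and> {x, y} = {j, k} \<and> fst F = {i, x} \<and> snd F = flip y (v - {x}))"
      if F: "F \<in> link_block e j k" and "j \<noteq> i" "k \<noteq> i" for j k
    proof -
      consider "fst F = {j, k}" | "F = shift (square_at e j) k" | "F = shift (square_at e k) j"
        using F unfolding link_block_def by fastforce
      then show ?thesis
      proof cases
        case 1
        then show ?thesis using that by simp
      next
        case 2
        then have "fst F = {i, j} \<and> snd F = flip k (v - {j})"
          by (simp add: ei shift_def square_at_def insert_commute)
        then show ?thesis using that by (intro disjI2 exI[of _ j] exI[of _ k]) simp
      next
        case 3
        then have "fst F = {i, k} \<and> snd F = flip j (v - {k})"
          by (simp add: ei shift_def square_at_def insert_commute)
        then show ?thesis using that by (intro disjI2 exI[of _ k] exI[of _ j]) (simp add: insert_commute)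
      qed
    qed
    have pair: "{i, x} = {i, y} \<longleftrightarrow> x = y" if "x \<noteq> i" "y \<noteq> i" for x y
      using that by (auto simp: doubleton_eq_iff)
    have "{j, k} = {j', k'}"
    proof (cases "i \<in> fst F")
      case False
      then show ?thesis using kinds[OF F(1)] kinds[OF F(2)] ni by auto
    next
      case True
      obtain x y where x: "x \<noteq> i" "{x, y} = {j, k}" "fst F = {i, x}" "snd F = flip y (v - {x})"
        using kinds[OF F(1)] True ni by metis
      obtain x' y' where x': "x' \<noteq> i" "{x', y'} = {j', k'}" "fst F = {i, x'}" "snd F = flip y' (v - {x'})"
        using kinds[OF F(2)] True ni by metis
      have "x = x'" using pair[OF x(1) x'(1)] x(3) x'(3) by simp
      moreover have "y = y'" using x(4) x'(4) flip_inj \<open>x = x'\<close> by simp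
      ultimately show ?thesis using x(2) x'(2) by simp
    qed
    then show ?thesis using ne by (simp add: doubleton_eq_iff)
  qed
  then show ?thesis unfolding disjoint_family_on_def by blast
qed

text \<open>
  Each of the at least \<open>n\<^sup>2/1000000\<close> pairs across the cut is joined with probability at least
  \<open>1/16\<close>, independently.
\<close>

lemma prob_link_not_mixed:
  assumes p: "1 / 2 \<le> p" "p \<le> 1" and e: "e \<in> cube_faces n 1" and A: "A \<subseteq> directions n e"
    and large: "real n / 1000 \<le> real (card A)" "real n / 1000 \<le> real (card (directions n e - A))"
  shows "measure_pmf.prob (coins (cube_faces n 2) p)
      {\<omega>. \<forall>j\<in>A. \<forall>k\<in>directions n e - A. \<not> link_block e j k \<subseteq> present n \<omega>} \<le> (15 / 16) powr (real n ^ 2 / 1000000)"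
proof -
  let ?J = "A \<times> (directions n e - A)"
  let ?b = "\<lambda>(j, k). link_block e j k"
  have finJ: "finite ?J" using A finite_subset[OF A] by simp
  have sub: "?b x \<subseteq> cube_faces n 2 \<and> card (?b x) \<le> 4" if xJ: "x \<in> ?J" for x
  proof -
    obtain j k where x: "x = (j, k)" "j \<in> A" "k \<in> directions n e" "k \<notin> A" using xJ by blast
    then have "j \<in> directions n e" "j \<noteq> k" using A by auto
    then show ?thesis using link_block_subset[OF e _ x(3)] by (simp add: x(1))
  qed
  have "{\<omega>. \<forall>j\<in>A. \<forall>k\<in>directions n e - A. \<not> link_block e j k \<subseteq> present n \<omega>} = {\<omega>. \<forall>x\<in>?J. \<exists>F\<in>?b x. \<not> \<omega> F}"
  proof (rule Collect_cong)
    fix \<omega>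
    have eq: "(\<not> ?b x \<subseteq> present n \<omega>) \<longleftrightarrow> (\<exists>F\<in>?b x. \<not> \<omega> F)" if "x \<in> ?J" for x
      using sub[OF that] by (auto simp: present_def)
    have "(\<forall>j\<in>A. \<forall>k\<in>directions n e - A. \<not> link_block e j k \<subseteq> present n \<omega>) \<longleftrightarrow> (\<forall>x\<in>?J. \<not> ?b x \<subseteq> present n \<omega>)"
      by auto
    also have "\<dots> \<longleftrightarrow> (\<forall>x\<in>?J. \<exists>F\<in>?b x. \<not> \<omega> F)" using eq by (rule ball_cong[OF refl])
    finally show "(\<forall>j\<in>A. \<forall>k\<in>directions n e - A. \<not> link_block e j k \<subseteq> present n \<omega>) \<longleftrightarrow> (\<forall>x\<in>?J. \<exists>F\<in>?b x. \<not> \<omega> F)" .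
  qed
  then have "measure_pmf.prob (coins (cube_faces n 2) p)
      {\<omega>. \<forall>j\<in>A. \<forall>k\<in>directions n e - A. \<not> link_block e j k \<subseteq> present n \<omega>} = (\<Prod>x\<in>?J. 1 - p ^ card (?b x))"
    using prob_no_block_all_heads[OF finite_cube_faces finJ _ _ _ link_blocks_disjoint[OF e A]] sub p by simp
  also have "\<dots> \<le> (\<Prod>x\<in>?J. 15 / 16)"
  proof (rule prod_mono, intro conjI)
    fix x assume x: "x \<in> ?J"
    show "0 \<le> 1 - p ^ card (?b x)" using p by (simp add: power_le_one)
    have "(1 / 16 :: real) = (1 / 2) ^ 4" by (simp add: power_divide)
    also have "\<dots> \<le> (1 / 2) ^ card (?b x)" using sub[OF x] by (intro power_decreasing) auto
    also have "\<dots> \<le> p ^ card (?b x)" using p by (intro power_mono) auto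
    finally show "1 - p ^ card (?b x) \<le> 15 / 16" by simp
  qed
  also have "\<dots> = (15 / 16) powr real (card A * card (directions n e - A))"
    by (simp add: powr_realpow[symmetric] card_cartesian_product)
  also have "\<dots> \<le> (15 / 16) powr (real n ^ 2 / 1000000)"
  proof (rule powr_mono')
    have "(real n / 1000) * (real n / 1000) \<le> real (card A) * real (card (directions n e - A))"
      using large by (intro mult_mono) auto
    then show "real n ^ 2 / 1000000 \<le> real (card A * card (directions n e - A))" by (simp add: power2_eq_square)
  qed auto
  finally show ?thesis .
qed

lemma prob_not_mixes_links:
  assumes p: "1 / 2 \<le> p" "p \<le> 1"
  shows "measure_pmf.prob (coins (cube_faces n 2) p) {\<omega>. \<not> mixes_links n (present n \<omega>)} \<le>
    (4 ^ n * 2 ^ n) * (15 / 16) powr (real n ^ 2 / 1000000)"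
proof (rule prob_UN_bound)
  let ?I = "{(e, A). e \<in> cube_faces n 1 \<and> A \<subseteq> directions n e \<and>
    real n / 1000 \<le> real (card A) \<and> real n / 1000 \<le> real (card (directions n e - A))}"
  let ?F = "\<lambda>(e, A). {\<omega>. \<forall>j\<in>A. \<forall>k\<in>directions n e - A. \<not> link_block e j k \<subseteq> present n \<omega>}"
  have sub: "?I \<subseteq> cube_faces n 1 \<times> Pow {..<n}" by (auto simp: directions_def)
  have fin: "finite (cube_faces n 1 \<times> Pow {..<n})" using finite_cube_faces by simp
  show "finite ?I" using sub fin by (rule finite_subset)
  show "{\<omega>. \<not> mixes_links n (present n \<omega>)} \<subseteq> (\<Union>i\<in>?I. ?F i)"
  proof
    fix \<omega> assume "\<omega> \<in> {\<omega>. \<not> mixes_links n (present n \<omega>)}"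
    then obtain e A where eA: "e \<in> cube_faces n 1" "A \<subseteq> directions n e"
      "real n / 1000 \<le> real (card A) \<and> real n / 1000 \<le> real (card (directions n e - A))"
      "\<not> (\<exists>j\<in>A. \<exists>k\<in>directions n e - A. link_block e j k \<subseteq> present n \<omega>)"
      unfolding mixes_links_def by blast
    have "(e, A) \<in> ?I" using eA(1,2,3) by simp
    moreover have "\<omega> \<in> ?F (e, A)" using eA(4) by simp
    ultimately show "\<omega> \<in> (\<Union>i\<in>?I. ?F i)" by (rule UN_I)
  qed
  show "measure_pmf.prob (coins (cube_faces n 2) p) (?F i) \<le> (15 / 16) powr (real n ^ 2 / 1000000)" if i: "i \<in> ?I" for i
  proof -
    obtain e A where "i = (e, A)" by (cases i)
    then show ?thesis using prob_link_not_mixed[OF p, of e n A] i by simp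
  qed
  have "card ?I \<le> card (cube_faces n 1 \<times> Pow {..<n})" using sub fin by (rule card_mono[rotated])
  also have "\<dots> = card (cube_faces n 1) * 2 ^ n" by (simp add: card_cartesian_product card_Pow)
  finally have "real (card ?I) \<le> real (card (cube_faces n 1) * 2 ^ n)" by (simp only: of_nat_le_iff)
  then have "real (card ?I) \<le> real (card (cube_faces n 1)) * 2 ^ n" by (simp only: of_nat_mult of_nat_power of_nat_numeral)
  also have "\<dots> \<le> 4 ^ n * 2 ^ n" using card_cube_faces_le by (rule mult_right_mono) simp
  finally show "real (card ?I) \<le> 4 ^ n * 2 ^ n" .
qed simp

lemma card_increasing_pairs:
  fixes D :: "nat set"
  assumes "finite D"
  shows "2 * card {(k, l). k \<in> D \<and> l \<in> D \<and> k < l} = card D * (card D - 1)"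
proof -
  let ?P = "{(k, l). k \<in> D \<and> l \<in> D \<and> k < l}"
  have fin: "finite ?P" by (rule finite_subset[of _ "D \<times> D"]) (use assms in auto)
  have "D \<times> D = ?P \<union> prod.swap ` ?P \<union> (\<lambda>x. (x, x)) ` D"
    by (auto simp: image_iff)
  then have "card (D \<times> D) = card (?P \<union> prod.swap ` ?P \<union> (\<lambda>x. (x, x)) ` D)" by simp
  also have "\<dots> = card (?P \<union> prod.swap ` ?P) + card ((\<lambda>x. (x, x)) ` D)"
    by (rule card_Un_disjoint) (use fin assms in auto)
  also have "card (?P \<union> prod.swap ` ?P) = card ?P + card (prod.swap ` ?P)"
    by (rule card_Un_disjoint) (use fin in auto)
  also have "card (prod.swap ` ?P) = card ?P" by (rule card_image) simp
  also have "card ((\<lambda>x. (x, x)) ` D) = card D" by (rule card_image) (auto simp: inj_on_def)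
  finally show ?thesis by (simp add: card_cartesian_product diff_mult_distrib2)
qed

text \<open>
  Chernoff's bound with \<open>t = 1/4\<close> for the squares that arise from \<open>F\<close> by flipping two coordinates.
\<close>

lemma prob_few_double_shifts:
  assumes p: "1 / 2 \<le> p" "p \<le> 1" and F: "F \<in> cube_faces n 2"
  shows "measure_pmf.prob (coins (cube_faces n 2) p)
      {\<omega>. \<not> real n ^ 2 / 50 < real (card (double_shifts n (present n \<omega>) F))} \<le>
    (1 / 4) powr (- (real n ^ 2 / 50)) * (5 / 8) ^ ((n - 2) * (n - 3) div 2)"
proof -
  define D where "D = directions n F"
  define P where "P = {(k, l). k \<in> D \<and> l \<in> D \<and> k < l}"
  define h where "h = (\<lambda>(k, l). shift (shift F k) l)"
  have finD: "finite D" by (simp add: D_def)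
  have cD: "card D = n - 2" unfolding D_def using card_directions[OF F] .
  have "n - 2 - 1 = n - 3" by simp
  then have "2 * card P = (n - 2) * (n - 3)" using card_increasing_pairs[OF finD] unfolding P_def cD by metis
  then have cP: "card P = (n - 2) * (n - 3) div 2" by linarith
  have inj: "inj_on h P"
  proof (rule inj_onI)
    fix x y assume x: "x \<in> P" and y: "y \<in> P" and eq: "h x = h y"
    obtain k l where xk: "x = (k, l)" by (cases x)
    obtain k' l' where yk: "y = (k', l')" by (cases y)
    have lt: "k < l" "k' < l'" using x y by (auto simp: xk yk P_def)
    define v where "v = snd F"
    define sd where "sd u = (u - v) \<union> (v - u)" for u
    have fl: "flip l (flip k v) = flip l' (flip k' v)" using eq by (auto simp: h_def xk yk shift_def v_def)
    have "sd (flip b (flip a v)) = {a, b}" if "a < b" for a b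
      using that by (auto simp: sd_def flip_def split: if_splits)
    from this[OF lt(1)] this[OF lt(2)] have "{k, l} = {k', l'}" by (simp only: fl)
    then show "x = y" using lt by (auto simp: xk yk doubleton_eq_iff)
  qed
  have hP: "h ` P \<subseteq> cube_faces n 2"
    using shift_in_cube_faces[OF shift_in_cube_faces[OF F]] by (auto simp: h_def P_def D_def)
  have card_eq: "card (double_shifts n (present n \<omega>) F) = card {x \<in> h ` P. \<omega> x}" for \<omega>
  proof -
    have "{x \<in> h ` P. \<omega> x} = h ` double_shifts n (present n \<omega>) F"
    proof -
      have "x \<in> P \<Longrightarrow> \<omega> (h x) \<longleftrightarrow> x \<in> double_shifts n (present n \<omega>) F" for x
        using hP by (auto simp: double_shifts_def P_def D_def h_def present_def)
      moreover have "double_shifts n (present n \<omega>) F \<subseteq> P" by (auto simp: double_shifts_def P_def D_def)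
      ultimately show ?thesis by blast
    qed
    moreover have "inj_on h (double_shifts n (present n \<omega>) F)"
      by (rule inj_on_subset[OF inj]) (auto simp: double_shifts_def P_def D_def)
    ultimately show ?thesis by (simp add: card_image)
  qed
  have "measure_pmf.prob (coins (cube_faces n 2) p) {\<omega>. real (card {x \<in> h ` P. \<omega> x}) \<le> real n ^ 2 / 50}
     \<le> (1 / 4) powr (- (real n ^ 2 / 50)) * ((1 + 1 / 4) / 2) ^ card (h ` P)"
    by (rule prob_few_heads[OF finite_cube_faces hP p]) auto
  then show ?thesis unfolding card_eq by (simp add: card_image[OF inj] cP not_less)
qed

lemma prob_not_rich_in_double_shifts:
  assumes p: "1 / 2 \<le> p" "p \<le> 1"
  shows "measure_pmf.prob (coins (cube_faces n 2) p) {\<omega>. \<not> rich_in_double_shifts n (present n \<omega>)} \<le>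
    4 ^ n * ((1 / 4) powr (- (real n ^ 2 / 50)) * (5 / 8) ^ ((n - 2) * (n - 3) div 2))"
  by (rule prob_UN_bound[OF finite_cube_faces _ prob_few_double_shifts[OF p] card_cube_faces_le])
    (auto simp: rich_in_double_shifts_def)

lemma squeeze_to_0:
  fixes f :: "nat \<Rightarrow> real"
  assumes "\<And>n. 0 \<le> f n" "eventually (\<lambda>n. f n \<le> g n) sequentially" "g \<longlonglongrightarrow> 0"
  shows "f \<longlonglongrightarrow> 0"
  by (rule tendsto_sandwich[OF _ assms(2) tendsto_const assms(3)]) (simp add: assms(1))

lemma sparse_bound_tendsto_0:
  "(\<lambda>n. (real n * 2 ^ n) * (5 * real n ^ 5) * ((1 / 10) powr (- (real n / 500)) * (11 / 20) ^ (2 * n - 3))) \<longlonglongrightarrow> 0"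
proof (rule squeeze_to_0)
  show "eventually (\<lambda>n. (real n * 2 ^ n) * (5 * real n ^ 5) * ((1 / 10) powr (- (real n / 500)) * (11 / 20) ^ (2 * n - 3))
      \<le> 50 * real n ^ 6 * (7 / 10) ^ n) sequentially"
  proof (rule eventually_sequentiallyI[of 2])
    fix n :: nat assume n: "2 \<le> n"
    \<comment> \<open>the exact base 10 powr (1 / 500) is replaced by a rational number with 2 * (21 / 20) * (11 / 20)^2 < 7 / 10\<close>
    have "(1 / 10 :: real) powr (- (1 / 500)) \<le> 21 / 20"
    proof -
      have "(1 / 10 :: real) powr (- (1 / 500)) = 10 powr (1 / 500)" by (simp add: powr_minus powr_divide)
      also have "\<dots> \<le> ((21 / 20) powr 500) powr (1 / 500)"
      proof (rule powr_mono2)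
        have "(21 / 20 :: real) powr 500 = (21 / 20) ^ 500" by (simp add: powr_numeral)
        moreover have "(10 :: real) \<le> (21 / 20) ^ 50" by (simp add: field_simps)
        moreover have "(21 / 20 :: real) ^ 50 \<le> (21 / 20) ^ 500" by (rule power_increasing) auto
        ultimately show "(10 :: real) \<le> (21 / 20) powr 500" by linarith
      qed auto
      also have "\<dots> = (21 / 20) powr (500 * (1 / 500))" by (rule powr_powr)
      also have "\<dots> = 21 / 20" by simp
      finally show ?thesis .
    qed
    then have "((1 / 10 :: real) powr (- (1 / 500))) ^ n \<le> (21 / 20) ^ n" by (rule power_mono) simp
    moreover have "(1 / 10 :: real) powr (- (real n / 500)) = ((1 / 10) powr (- (1 / 500))) ^ n"
      by (simp add: powr_realpow[symmetric] powr_powr)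
    ultimately have 1: "(1 / 10 :: real) powr (- (real n / 500)) \<le> (21 / 20) ^ n" by simp
    have "(11 / 20 :: real) ^ (2 * n) = (11 / 20) ^ (2 * n - 3) * (11 / 20) ^ 3" using n by (simp flip: power_add)
    moreover have "(11 / 20 :: real) ^ (2 * n) = (121 / 400) ^ n" by (simp add: power_mult power2_eq_square)
    moreover have "(11 / 20 :: real) ^ 3 = 1331 / 8000" by (simp add: power3_eq_cube)
    moreover have "0 \<le> (121 / 400 :: real) ^ n" by simp
    ultimately have "(121 / 400 :: real) ^ n = (11 / 20) ^ (2 * n - 3) * (1331 / 8000)" "0 \<le> (121 / 400 :: real) ^ n"
      by simp_all
    then have 2: "(11 / 20 :: real) ^ (2 * n - 3) \<le> 10 * (121 / 400) ^ n" by linarith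
    have "(real n * 2 ^ n) * (5 * real n ^ 5) * ((1 / 10) powr (- (real n / 500)) * (11 / 20) ^ (2 * n - 3))
      \<le> (real n * 2 ^ n) * (5 * real n ^ 5) * ((21 / 20) ^ n * (10 * (121 / 400) ^ n))"
      using 1 2 by (intro mult_left_mono mult_mono) auto
    also have "\<dots> = 50 * (real n * real n ^ 5) * (2 ^ n * (21 / 20) ^ n * (121 / 400) ^ n)" by simp
    also have "\<dots> = 50 * real n ^ 6 * (2 * (21 / 20) * (121 / 400)) ^ n"
      by (simp only: power_mult_distrib flip: power_Suc) simp
    also have "\<dots> \<le> 50 * real n ^ 6 * (7 / 10) ^ n" by (intro mult_left_mono power_mono) auto
    finally show "(real n * 2 ^ n) * (5 * real n ^ 5) * ((1 / 10) powr (- (real n / 500)) * (11 / 20) ^ (2 * n - 3))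
      \<le> 50 * real n ^ 6 * (7 / 10) ^ n" .
  qed
  show "(\<lambda>n. 50 * real n ^ 6 * (7 / 10) ^ n) \<longlonglongrightarrow> 0" by real_asymp
qed simp

lemma link_bound_tendsto_0:
  "(\<lambda>n. (4 ^ n * 2 ^ n) * (15 / 16) powr (real n ^ 2 / 1000000)) \<longlonglongrightarrow> (0 :: real)"
  by real_asymp

lemma double_shift_bound_tendsto_0:
  "(\<lambda>n. 4 ^ n * ((1 / 4) powr (- (real n ^ 2 / 50)) * (5 / 8) ^ ((n - 2) * (n - 3) div 2))) \<longlonglongrightarrow> (0 :: real)"
proof (rule squeeze_to_0)
  show "eventually (\<lambda>n. 4 ^ n * ((1 / 4) powr (- (real n ^ 2 / 50)) * (5 / 8) ^ ((n - 2) * (n - 3) div 2))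
      \<le> 4 ^ n * (9 / 10) powr (real n ^ 2 / 10)) sequentially"
  proof (rule eventually_sequentiallyI[of 100])
    fix n :: nat assume n: "100 \<le> n"
    have "real ((n - 2) * (n - 3) div 2) \<ge> real ((n - 2) * (n - 3)) / 2 - 1" by linarith
    moreover have "real ((n - 2) * (n - 3)) = (real n - 2) * (real n - 3)" using n by simp
    moreover have "100 * real n \<le> real n * real n" using n by (intro mult_right_mono) auto
    moreover have "(real n - 2) * (real n - 3) = real n * real n - 5 * real n + 6" by (simp add: algebra_simps)
    moreover have "real n ^ 2 = real n * real n" by (rule power2_eq_square)
    moreover have "100 \<le> real n" using n by simp
    ultimately have e: "2 * real n ^ 2 / 5 \<le> real ((n - 2) * (n - 3) div 2)" by linarith
    \<comment> \<open>per n^2 / 10, the first factor grows by 4 powr (1 / 5) < 4 / 3 and the second decays by (5 / 8)^4\<close>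
    have "(1 / 4 :: real) powr (- (real n ^ 2 / 50)) = ((4 :: real) powr (1 / 5)) powr (real n ^ 2 / 10)"
      by (simp add: powr_minus powr_divide powr_powr)
    also have "\<dots> \<le> (4 / 3) powr (real n ^ 2 / 10)"
    proof (rule powr_mono2)
      have "(4 :: real) powr (1 / 5) \<le> ((4 / 3) ^ 5) powr (1 / 5)" by (rule powr_mono2) (auto simp: power_divide)
      also have "\<dots> = (4 / 3) powr (5 * (1 / 5))" by (simp add: powr_powr flip: powr_numeral)
      finally show "(4 :: real) powr (1 / 5) \<le> 4 / 3" by simp
    qed auto
    finally have 1: "(1 / 4 :: real) powr (- (real n ^ 2 / 50)) \<le> (4 / 3) powr (real n ^ 2 / 10)" .
    have "(5 / 8 :: real) ^ ((n - 2) * (n - 3) div 2) = (5 / 8) powr real ((n - 2) * (n - 3) div 2)"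
      by (rule powr_realpow[symmetric]) simp
    also have "\<dots> \<le> (5 / 8) powr (2 * real n ^ 2 / 5)" using e by (intro powr_mono') auto
    also have "\<dots> = ((5 / 8) powr 4) powr (real n ^ 2 / 10)" by (simp only: powr_powr) simp
    also have "\<dots> = ((5 / 8) ^ 4) powr (real n ^ 2 / 10)" by (simp add: powr_numeral)
    finally have 2: "(5 / 8 :: real) ^ ((n - 2) * (n - 3) div 2) \<le> ((5 / 8) ^ 4) powr (real n ^ 2 / 10)" .
    have "4 ^ n * ((1 / 4) powr (- (real n ^ 2 / 50)) * (5 / 8) ^ ((n - 2) * (n - 3) div 2))
      \<le> 4 ^ n * ((4 / 3) powr (real n ^ 2 / 10) * ((5 / 8) ^ 4) powr (real n ^ 2 / 10) :: real)"
      using 1 2 by (intro mult_left_mono mult_mono) auto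
    also have "\<dots> = 4 ^ n * ((4 / 3) * (5 / 8) ^ 4) powr (real n ^ 2 / 10)"
      by (subst powr_mult) auto
    also have "\<dots> \<le> 4 ^ n * (9 / 10) powr (real n ^ 2 / 10)"
      by (intro mult_left_mono powr_mono2) (auto simp: power_divide)
    finally show "4 ^ n * ((1 / 4) powr (- (real n ^ 2 / 50)) * (5 / 8) ^ ((n - 2) * (n - 3) div 2))
      \<le> 4 ^ n * (9 / 10 :: real) powr (real n ^ 2 / 10)" .
  qed
  show "(\<lambda>n. 4 ^ n * (9 / 10 :: real) powr (real n ^ 2 / 10)) \<longlonglongrightarrow> 0" by real_asymp
qed simp

section \<open>Poisson limit for the number of isolated edges\<close>

text \<open>
  By \<open>choose_mult\<close> the sum is \<open>N choose k\<close> times a truncated alternating sum of the binomial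
  coefficients \<open>N - k choose j\<close>, whose sign is known in closed form.
\<close>

lemma bonferroni:
  fixes N k m :: nat
  defines "S \<equiv> \<Sum>j\<le>m. (-1) ^ j * real (k + j choose k) * real (N choose (k + j))"
  shows "even m \<Longrightarrow> (if N = k then 1 else 0) \<le> S" "odd m \<Longrightarrow> S \<le> (if N = k then 1 else 0)"
proof -
  have summand: "real (k + j choose k) * real (N choose (k + j)) = real (N choose k) * real (N - k choose j)" for j
  proof (cases "k + j \<le> N")
    case True
    then have "(N choose (k + j)) * (k + j choose k) = (N choose k) * (N - k choose (k + j - k))"
      by (intro choose_mult) auto
    then show ?thesis by (metis mult.commute of_nat_mult add_diff_cancel_left')
  next
    case False
    then show ?thesis by (cases "k \<le> N") (auto simp: binomial_eq_0)
  qed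
  have S: "S = real (N choose k) * (\<Sum>j\<le>m. (-1) ^ j * real (N - k choose j))"
    unfolding S_def sum_distrib_left by (intro sum.cong refl) (simp add: summand mult.assoc mult.left_commute)
  have gt: "S = real (N choose k) * ((-1) ^ m * real (N - k - 1 choose m))" if "N > k"
  proof -
    have "(\<Sum>j\<le>m. (-1) ^ j * real (N - k choose j)) = (\<Sum>j\<le>m. (real (N - k) gchoose j) * (-1) ^ j)"
      by (simp add: binomial_gbinomial mult.commute)
    also have "\<dots> = (-1) ^ m * (real (N - k) - 1 gchoose m)" by (rule gbinomial_sum_lower_neg)
    also have "real (N - k) - 1 = real (N - k - 1)" using that by simp
    finally show ?thesis unfolding S by (simp only: binomial_gbinomial)
  qed
  have eq: "S = 1" if "N = k"
  proof -
    have "(\<Sum>j\<le>m. (-1) ^ j * real (N - k choose j)) = (\<Sum>j\<le>m. if j = 0 then 1 else 0)"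
      using that by (intro sum.cong refl) (auto simp: binomial_eq_0)
    then show ?thesis using that by (simp add: S)
  qed
  have lt: "S = 0" if "N < k" using that by (simp add: S binomial_eq_0)
  show "even m \<Longrightarrow> (if N = k then 1 else 0) \<le> S"
    by (cases N k rule: linorder_cases) (auto simp: eq lt gt)
  show "odd m \<Longrightarrow> S \<le> (if N = k then 1 else 0)"
    by (cases N k rule: linorder_cases) (auto simp: eq lt gt)
qed

text \<open>
  The Bonferroni inequalities bound the probability from both sides by finite combinations of
  moments. The limits of these bounds are partial sums of the exponential series for \<open>exp (- lam)\<close>,
  so they come arbitrarily close to the Poisson weight.
\<close>

lemma poisson_limit_of_binomial_moments:
  fixes M :: "nat \<Rightarrow> 'a pmf" and X :: "nat \<Rightarrow> 'a \<Rightarrow> nat" and lam :: real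
  assumes fin: "\<And>n. finite (set_pmf (M n))"
    and mom: "\<And>r. (\<lambda>n. measure_pmf.expectation (M n) (\<lambda>\<omega>. real (X n \<omega> choose r))) \<longlonglongrightarrow> lam ^ r / fact r"
  shows "(\<lambda>n. measure_pmf.prob (M n) {\<omega>. X n \<omega> = k}) \<longlonglongrightarrow> lam ^ k * exp (- lam) / fact k"
proof -
  define S where "S m N = (\<Sum>j\<le>m. (-1) ^ j * real (k + j choose k) * real (N choose (k + j)))" for m N
  define L where "L m = (\<Sum>j\<le>m. (-1) ^ j * real (k + j choose k) * (lam ^ (k + j) / fact (k + j)))" for m
  have int: "integrable (measure_pmf (M n)) g" for g :: "_ \<Rightarrow> real" and n
    by (rule integrable_measure_pmf_finite[OF fin])
  have ES: "measure_pmf.expectation (M n) (\<lambda>\<omega>. S m (X n \<omega>)) =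
      (\<Sum>j\<le>m. (-1) ^ j * real (k + j choose k) * measure_pmf.expectation (M n) (\<lambda>\<omega>. real (X n \<omega> choose (k + j))))" for m n
    unfolding S_def by (subst Bochner_Integration.integral_sum[OF int]) simp
  have limS: "(\<lambda>n. measure_pmf.expectation (M n) (\<lambda>\<omega>. S m (X n \<omega>))) \<longlonglongrightarrow> L m" for m
    unfolding ES L_def by (intro tendsto_intros mom)
  have Pexp: "measure_pmf.prob (M n) {\<omega>. X n \<omega> = k} = measure_pmf.expectation (M n) (indicator {\<omega>. X n \<omega> = k})" for n
    by simp
  have up: "measure_pmf.prob (M n) {\<omega>. X n \<omega> = k} \<le> measure_pmf.expectation (M n) (\<lambda>\<omega>. S m (X n \<omega>))" if "even m" for n m
    unfolding Pexp
  proof (rule integral_mono[OF int int])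
    show "indicator {\<omega>. X n \<omega> = k} \<omega> \<le> S m (X n \<omega>)" for \<omega>
      using bonferroni(1)[OF that, where N = "X n \<omega>" and k = k] unfolding S_def indicator_def mem_Collect_eq of_bool_def .
  qed
  have low: "measure_pmf.expectation (M n) (\<lambda>\<omega>. S m (X n \<omega>)) \<le> measure_pmf.prob (M n) {\<omega>. X n \<omega> = k}" if "odd m" for n m
    unfolding Pexp
  proof (rule integral_mono[OF int int])
    show "S m (X n \<omega>) \<le> indicator {\<omega>. X n \<omega> = k} \<omega>" for \<omega>
      using bonferroni(2)[OF that, where N = "X n \<omega>" and k = k] unfolding S_def indicator_def mem_Collect_eq of_bool_def .
  qed
  have L_eq: "L m = lam ^ k / fact k * (\<Sum>j\<le>m. (- lam) ^ j /\<^sub>R fact j)" for m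
    unfolding L_def sum_distrib_left
  proof (intro sum.cong refl)
    fix j
    have "real (k + j choose k) = fact (k + j) / (fact k * fact j)"
      using binomial_fact[of k "k + j", where 'a = real] by simp
    then show "(-1) ^ j * real (k + j choose k) * (lam ^ (k + j) / fact (k + j)) = lam ^ k / fact k * ((- lam) ^ j /\<^sub>R fact j)"
      by (simp add: power_add power_minus[of lam] divide_inverse mult_ac)
  qed
  have "(\<lambda>m. \<Sum>j\<le>m. (- lam) ^ j /\<^sub>R fact j) \<longlonglongrightarrow> exp (- lam)"
    using exp_converges[of "- lam"] by (simp add: sums_def_le)
  then have limL: "L \<longlonglongrightarrow> lam ^ k * exp (- lam) / fact k"
    unfolding L_eq[abs_def] by (auto intro!: tendsto_eq_intros)
  have ev: "\<exists>m. even m \<and> P m" "\<exists>m. odd m \<and> P m" if P: "eventually P sequentially" for P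
  proof -
    obtain N where "\<And>m. m \<ge> N \<Longrightarrow> P m" using P by (auto simp: eventually_sequentially)
    then have "P (2 * N)" "P (2 * N + 1)" by auto
    then show "\<exists>m. even m \<and> P m" "\<exists>m. odd m \<and> P m" by (auto intro: exI[of _ "2 * N"] exI[of _ "2 * N + 1"])
  qed
  show ?thesis
  proof (rule order_tendstoI)
    fix a assume "a < lam ^ k * exp (- lam) / fact k"
    then have "eventually (\<lambda>m. a < L m) sequentially" by (rule order_tendstoD(1)[OF limL])
    then obtain m where m: "odd m" "a < L m" using ev(2) by blast
    have "eventually (\<lambda>n. a < measure_pmf.expectation (M n) (\<lambda>\<omega>. S m (X n \<omega>))) sequentially"
      by (rule order_tendstoD(1)[OF limS m(2)])
    then show "eventually (\<lambda>n. a < measure_pmf.prob (M n) {\<omega>. X n \<omega> = k}) sequentially"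
      by eventually_elim (rule less_le_trans[OF _ low[OF m(1)]])
  next
    fix a assume "lam ^ k * exp (- lam) / fact k < a"
    then have "eventually (\<lambda>m. L m < a) sequentially" by (rule order_tendstoD(2)[OF limL])
    then obtain m where m: "even m" "L m < a" using ev(1) by blast
    have "eventually (\<lambda>n. measure_pmf.expectation (M n) (\<lambda>\<omega>. S m (X n \<omega>)) < a) sequentially"
      by (rule order_tendstoD(2)[OF limS m(2)])
    then show "eventually (\<lambda>n. measure_pmf.prob (M n) {\<omega>. X n \<omega> = k} < a) sequentially"
      by eventually_elim (rule le_less_trans[OF up[OF m(1)]])
  qed
qed

lemma binomial_over_power_tendsto: "(\<lambda>N. real (N choose r) / real N ^ r) \<longlonglongrightarrow> 1 / fact r"
proof -
  have "(\<lambda>N. \<Prod>i=0..<r. (real N - real i) / real N / real (r - i)) \<longlonglongrightarrow> (\<Prod>i=0..<r. 1 / real (r - i))"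
  proof (intro tendsto_prod)
    fix i assume "i \<in> {0..<r}"
    have "(\<lambda>N. (real N - real i) / real N) \<longlonglongrightarrow> 1" by real_asymp
    then show "(\<lambda>N. (real N - real i) / real N / real (r - i)) \<longlonglongrightarrow> 1 / real (r - i)"
      using \<open>i \<in> {0..<r}\<close> by (intro tendsto_divide) auto
  qed
  moreover have "eventually (\<lambda>N. (\<Prod>i=0..<r. (real N - real i) / real N / real (r - i)) = real (N choose r) / real N ^ r) sequentially"
  proof (rule eventually_sequentiallyI[of r])
    fix N assume N: "r \<le> N"
    have "real (N choose r) / real N ^ r = (\<Prod>i=0..<r. real (N - i) / real (r - i)) / (\<Prod>i=0..<r. real N)"
      using N by (simp add: binomial_altdef_of_nat)
    also have "\<dots> = (\<Prod>i=0..<r. (real N - real i) / real N / real (r - i))"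
      unfolding prod_dividef[symmetric] using N by (intro prod.cong refl) (simp add: of_nat_diff field_simps)
    finally show "(\<Prod>i=0..<r. (real N - real i) / real N / real (r - i)) = real (N choose r) / real N ^ r" by simp
  qed
  moreover have "(\<Prod>i=0..<r. 1 / real (r - i)) = 1 / fact r"
  proof -
    have "(\<Prod>i=0..<r. real (r - i)) = fact r" by (simp add: fact_prod_rev)
    then show ?thesis by (simp add: prod_dividef)
  qed
  ultimately show ?thesis using tendsto_cong by fastforce
qed

lemma card_edges: "card (cube_faces n 1) = n * 2 ^ (n - 1)"
proof -
  let ?S = "SIGMA i:{..<n}. Pow ({..<n} - {i})"
  have "cube_faces n 1 = (\<lambda>(i, v). ({i}, v)) ` ?S"
    by (auto simp: cube_faces_def card_1_singleton_iff image_iff)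
  moreover have "inj_on (\<lambda>(i, v). ({i}, v)) ?S" by (auto simp: inj_on_def)
  ultimately have "card (cube_faces n 1) = card ?S" by (simp add: card_image)
  also have "\<dots> = (\<Sum>i<n. 2 ^ (n - 1))" by (subst card_SigmaI) (auto simp: card_Pow)
  finally show ?thesis by simp
qed

lemma isolated_edges_present: "isolated_edges n (present n \<omega>) = {e \<in> cube_faces n 1. \<forall>F\<in>star n e. \<not> \<omega> F}"
  by (auto simp: isolated_edges_def present_def star_def)

text \<open>
  The number of \<open>r\<close>-element sets of isolated edges is a sum of indicators, one for each set \<open>T\<close> of edges, of
  the event that no square of the stars of \<open>T\<close> is present.
\<close>

lemma binomial_moment_isolated:
  assumes p: "0 \<le> p" "p \<le> 1"
  shows "measure_pmf.expectation (coins (cube_faces n 2) p) (\<lambda>\<omega>. real (card (isolated_edges n (present n \<omega>)) choose r)) =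
    (\<Sum>T | T \<subseteq> cube_faces n 1 \<and> card T = r. (1 - p) ^ card (\<Union>e\<in>T. star n e))"
proof -
  let ?T = "{T. T \<subseteq> cube_faces n 1 \<and> card T = r}"
  have int: "integrable (measure_pmf (coins (cube_faces n 2) p)) g" for g :: "_ \<Rightarrow> real"
    by (rule integrable_measure_pmf_finite[OF finite_set_pmf_coins[OF finite_cube_faces]])
  have finT: "finite ?T" by (rule finite_subset[of _ "Pow (cube_faces n 1)"]) (auto simp: finite_cube_faces)
  have ch: "real (card (isolated_edges n (present n \<omega>)) choose r) =
     (\<Sum>T\<in>?T. indicator {\<omega>. \<forall>F\<in>(\<Union>e\<in>T. star n e). \<not> \<omega> F} \<omega>)" for \<omega>
  proof -
    have "finite (isolated_edges n (present n \<omega>))" by (simp add: isolated_edges_def finite_cube_faces)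
    then have "card (isolated_edges n (present n \<omega>)) choose r = card {T. T \<subseteq> isolated_edges n (present n \<omega>) \<and> card T = r}"
      by (simp add: n_subsets)
    also have "{T. T \<subseteq> isolated_edges n (present n \<omega>) \<and> card T = r} = ?T \<inter> {T. \<forall>F\<in>(\<Union>e\<in>T. star n e). \<not> \<omega> F}"
      by (auto simp: isolated_edges_present)
    also have "real (card \<dots>) = (\<Sum>T\<in>?T. indicator {T. \<forall>F\<in>(\<Union>e\<in>T. star n e). \<not> \<omega> F} T)"
      using finT by (simp only: indicator_def sum_of_bool_eq Collect_mem_eq)
    also have "\<dots> = (\<Sum>T\<in>?T. indicator {\<omega>. \<forall>F\<in>(\<Union>e\<in>T. star n e). \<not> \<omega> F} \<omega>)"
      by (intro sum.cong refl) (simp add: indicator_def)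
    finally show ?thesis .
  qed
  have "measure_pmf.expectation (coins (cube_faces n 2) p) (\<lambda>\<omega>. real (card (isolated_edges n (present n \<omega>)) choose r)) =
    (\<Sum>T\<in>?T. measure_pmf.prob (coins (cube_faces n 2) p) {\<omega>. \<forall>F\<in>(\<Union>e\<in>T. star n e). \<not> \<omega> F})"
    unfolding ch by (subst Bochner_Integration.integral_sum[OF int]) simp
  also have "\<dots> = (\<Sum>T\<in>?T. (1 - p) ^ card (\<Union>e\<in>T. star n e))"
    by (intro sum.cong refl prob_all_tails[OF finite_cube_faces _ p]) (auto simp: star_def)
  finally show ?thesis .
qed

text \<open>
  Every new edge shares at most one square with each of the previous ones.
\<close>

lemma card_Union_star:
  assumes "finite T" "T \<subseteq> cube_faces n 1"
  shows "card (\<Union>e\<in>T. star n e) \<le> card T * (n - 1)" "card T * (n - 1) \<le> card (\<Union>e\<in>T. star n e) + card T * card T"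
proof -
  have "card (\<Union>e\<in>T. star n e) \<le> (\<Sum>e\<in>T. card (star n e))" using assms(1) by (rule card_UN_le)
  also have "\<dots> = (\<Sum>e\<in>T. n - 1)" using assms(2) card_star by (intro sum.cong) auto
  finally show "card (\<Union>e\<in>T. star n e) \<le> card T * (n - 1)" by simp
  show "card T * (n - 1) \<le> card (\<Union>e\<in>T. star n e) + card T * card T"
    using assms
  proof (induction T rule: finite_induct)
    case (insert x T)
    have fin: "finite (\<Union>e\<in>T. star n e)" using insert.hyps(1) finite_star by blast
    have "card (star n x) + card (\<Union>e\<in>T. star n e) = card (star n x \<union> (\<Union>e\<in>T. star n e)) + card (star n x \<inter> (\<Union>e\<in>T. star n e))"
      by (rule card_Un_Int[OF finite_star fin])
    moreover have "card (star n x \<inter> (\<Union>e\<in>T. star n e)) \<le> card T"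
    proof -
      have "card (star n x \<inter> (\<Union>e\<in>T. star n e)) = card (\<Union>e\<in>T. star n x \<inter> star n e)" by (simp only: Int_UN_distrib)
      also have "\<dots> \<le> (\<Sum>e\<in>T. card (star n x \<inter> star n e))" using insert.hyps(1) by (rule card_UN_le)
      also have "\<dots> \<le> (\<Sum>e\<in>T. 1)" using insert.hyps(2) insert.prems by (intro sum_mono card_star_Int) auto
      finally show ?thesis by simp
    qed
    moreover have "card (star n x) = n - 1" using card_star insert.prems by auto
    moreover have "card T * (n - 1) \<le> card (\<Union>e\<in>T. star n e) + card T * card T"
      using insert.IH insert.prems by blast
    moreover have "card (insert x T) = card T + 1" using insert.hyps by simp
    moreover have "(\<Union>e\<in>insert x T. star n e) = star n x \<union> (\<Union>e\<in>T. star n e)" by (rule UN_insert)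
    ultimately show ?case by (simp only: add_mult_distrib add_mult_distrib2 mult_1 mult_1_right)
  qed simp
qed

definition conflicting :: "nat \<Rightarrow> face set \<Rightarrow> bool" where
  "conflicting n T \<longleftrightarrow> (\<exists>e\<in>T. \<exists>e'\<in>T. e \<noteq> e' \<and> star n e \<inter> star n e' \<noteq> {})"

text \<open>
  A conflicting set consists of an edge, one of the at most \<open>4 n\<close> edges sharing a square with it, and
  \<open>r - 2\<close> further edges. The additional factor on the left avoids the exponent \<open>r - 1\<close>.
\<close>

lemma card_conflicting:
  "card {T. T \<subseteq> cube_faces n 1 \<and> card T = r \<and> conflicting n T} * card (cube_faces n 1) \<le> 4 * n * card (cube_faces n 1) ^ r"
proof (cases "r \<ge> 2")
  case False
  have "\<not> conflicting n T" if "T \<subseteq> cube_faces n 1" "card T = r" for T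
  proof
    assume "conflicting n T"
    then obtain e e' where "e \<in> T" "e' \<in> T" "e \<noteq> e'" unfolding conflicting_def by blast
    then have "card {e, e'} \<le> card T" using that by (intro card_mono) (auto intro: finite_subset[OF _ finite_cube_faces])
    then show False using \<open>e \<noteq> e'\<close> that False by simp
  qed
  then have "{T. T \<subseteq> cube_faces n 1 \<and> card T = r \<and> conflicting n T} = {}" by blast
  then show ?thesis by (simp only: card.empty)
next
  case True
  define E where "E = cube_faces n 1"
  have finE: "finite E" by (simp add: E_def finite_cube_faces)
  define con where "con e = {e' \<in> E. star n e \<inter> star n e' \<noteq> {}}" for e
  define R where "R = {T. T \<subseteq> E \<and> card T = r - 2}"
  have finR: "finite R" unfolding R_def using finE by simp
  have con: "card (con e) \<le> 4 * n" if "e \<in> E" for e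
  proof -
    have "con e \<subseteq> (\<Union>F\<in>star n e. facets F)" by (auto simp: con_def star_def)
    moreover have "finite (\<Union>F\<in>star n e. facets F)" using finite_star finite_facets by (auto simp: star_def)
    ultimately have "card (con e) \<le> card (\<Union>F\<in>star n e. facets F)" by (intro card_mono)
    also have "\<dots> \<le> (\<Sum>F\<in>star n e. card (facets F))" by (rule card_UN_le[OF finite_star])
    also have "\<dots> \<le> (\<Sum>F\<in>star n e. 4)"
    proof (rule sum_mono)
      fix F assume "F \<in> star n e"
      then obtain a b v where "F = ({a, b}, v)" "a < b" using cube_face_2E[of F n] unfolding star_def by blast
      then show "card (facets F) \<le> 4" by (auto simp: facets_square card_insert_if)
    qed
    also have "\<dots> \<le> 4 * n" using card_star that by (simp add: E_def)
    finally show ?thesis .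
  qed
  let ?D = "Sigma E (\<lambda>e. con e \<times> R)"
  have "{T. T \<subseteq> E \<and> card T = r \<and> conflicting n T} \<subseteq> (\<lambda>(e, e', T). insert e (insert e' T)) ` ?D"
  proof
    fix T assume "T \<in> {T. T \<subseteq> E \<and> card T = r \<and> conflicting n T}"
    then obtain e e' where T: "T \<subseteq> E" "card T = r" "e \<in> T" "e' \<in> T" "e \<noteq> e'" "star n e \<inter> star n e' \<noteq> {}"
      unfolding conflicting_def by blast
    have "finite T" using T(1) finE by (rule finite_subset)
    then have "card (T - {e} - {e'}) = r - 2" using T by simp
    then have "T - {e} - {e'} \<in> R" using T by (auto simp: R_def)
    moreover have "e' \<in> con e" using T by (auto simp: con_def)
    moreover have "T = insert e (insert e' (T - {e} - {e'}))" using T by blast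
    ultimately show "T \<in> (\<lambda>(e, e', T). insert e (insert e' T)) ` ?D" using T by (intro image_eqI[of _ _ "(e, e', T - {e} - {e'})"]) auto
  qed
  moreover have finD: "finite ?D" using finE finR by (auto simp: con_def)
  ultimately have "card {T. T \<subseteq> E \<and> card T = r \<and> conflicting n T} \<le> card ?D" by (meson surj_card_le)
  also have "\<dots> = (\<Sum>e\<in>E. card (con e) * card R)" using finE finR by (subst card_SigmaI) (auto simp: con_def card_cartesian_product)
  also have "\<dots> \<le> (\<Sum>e\<in>E. (4 * n) * card E ^ (r - 2))"
  proof (intro sum_mono mult_mono con)
    have "(card E choose (r - 2)) * 1 \<le> (card E choose (r - 2)) * fact (r - 2)" by (intro mult_left_mono) auto
    also have "\<dots> \<le> card E ^ (r - 2)" by (rule binomial_fact_pow)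
    finally show "card R \<le> card E ^ (r - 2)" unfolding R_def using finE by (simp add: n_subsets)
  qed auto
  finally have "card {T. T \<subseteq> E \<and> card T = r \<and> conflicting n T} * card E \<le> (card E * ((4 * n) * card E ^ (r - 2))) * card E"
    by (simp add: mult_right_mono)
  also have "\<dots> = 4 * n * card E ^ r"
  proof -
    have "card E ^ (r - 2) * card E ^ 2 = card E ^ (r - 2 + 2)" by (rule power_add[symmetric])
    then have "card E ^ r = card E ^ (r - 2) * card E ^ 2" using True by (simp only: le_add_diff_inverse2)
    then show ?thesis by (simp add: power2_eq_square)
  qed
  finally show ?thesis by (simp add: E_def)
qed

text \<open>
  Sets without conflict contribute exactly \<open>q ^ (r * (n - 1))\<close>. Sets with a conflict may save up
  to \<open>r\<^sup>2\<close> factors \<open>q \<ge> 1/4\<close>, but they are fewer by a factor of order \<open>n / card E\<close>.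
\<close>

lemma binomial_moment_bounds:
  fixes n r :: nat and q :: real
  assumes q: "1 / 4 \<le> q" "q \<le> 1"
  defines "E \<equiv> cube_faces n 1"
  defines "S \<equiv> \<Sum>T | T \<subseteq> E \<and> card T = r. q ^ card (\<Union>e\<in>T. star n e)"
  shows "real (card E choose r) * q ^ (r * (n - 1)) \<le> S"
    "n \<ge> 1 \<Longrightarrow> S \<le> real (card E choose r) * q ^ (r * (n - 1)) +
      4 * real n / real (card E) * 4 ^ (r * r) * (real (card E) * q ^ (n - 1)) ^ r"
proof -
  define R where "R = {T. T \<subseteq> E \<and> card T = r}"
  define C where "C = {T. T \<subseteq> E \<and> card T = r \<and> conflicting n T}"
  define a where "a = q ^ (r * (n - 1))"
  have a0: "0 \<le> a" using q by (simp add: a_def)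
  have finE: "finite E" by (simp add: E_def finite_cube_faces)
  have finR: "finite R" using finE by (simp add: R_def)
  have CR: "C \<subseteq> R" by (auto simp: C_def R_def)
  have T: "finite T" "T \<subseteq> cube_faces n 1" "card T = r" if "T \<in> R" for T
    using that finE finite_subset by (auto simp: R_def E_def)
  have cR: "card R = (card E choose r)" using finE by (simp add: R_def n_subsets)
  have S: "S = (\<Sum>T\<in>R. q ^ card (\<Union>e\<in>T. star n e))" by (simp add: S_def R_def)
  have "real (card R) * a \<le> (\<Sum>T\<in>R. q ^ card (\<Union>e\<in>T. star n e))"
  proof (rule sum_bounded_below)
    fix T assume "T \<in> R"
    then show "a \<le> q ^ card (\<Union>e\<in>T. star n e)"
      unfolding a_def using card_Union_star(1)[of T n] T q by (intro power_decreasing) auto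
  qed
  then show "real (card E choose r) * q ^ (r * (n - 1)) \<le> S" by (simp add: S cR a_def)
  assume n: "n \<ge> 1"
  have E0: "0 < real (card E)" using n by (simp only: E_def card_edges) simp
  have le: "q ^ card (\<Union>e\<in>T. star n e) \<le> (if T \<in> C then 4 ^ (r * r) * a else 0) + a" if "T \<in> R" for T
  proof (cases "T \<in> C")
    case True
    have "q ^ (card (\<Union>e\<in>T. star n e) + r * r) \<le> a"
      unfolding a_def using card_Union_star(2)[of T n] T[OF that] q by (intro power_decreasing) auto
    then have "q ^ card (\<Union>e\<in>T. star n e) * q ^ (r * r) * 4 ^ (r * r) \<le> a * 4 ^ (r * r)"
      by (intro mult_right_mono) (auto simp: power_add)
    moreover have "q ^ card (\<Union>e\<in>T. star n e) * 1 \<le> q ^ card (\<Union>e\<in>T. star n e) * (q * 4) ^ (r * r)"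
      using q by (intro mult_left_mono one_le_power) auto
    ultimately have "q ^ card (\<Union>e\<in>T. star n e) \<le> a * 4 ^ (r * r)"
      by (simp only: power_mult_distrib mult.assoc mult_1_right)
    then show ?thesis using True a0 by (simp add: mult.commute)
  next
    case False
    have "\<not> conflicting n T" using False that by (simp add: C_def R_def)
    then have "\<forall>e\<in>T. \<forall>e'\<in>T. e \<noteq> e' \<longrightarrow> star n e \<inter> star n e' = {}" unfolding conflicting_def by blast
    then have "card (\<Union>e\<in>T. star n e) = (\<Sum>e\<in>T. card (star n e))"
      using T(1)[OF that] finite_star by (intro card_UN_disjoint) blast+
    also have "\<dots> = (\<Sum>e\<in>T. n - 1)" using T(2)[OF that] card_star by (intro sum.cong) auto
    also have "\<dots> = r * (n - 1)" using T[OF that] by simp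
    finally show ?thesis using False by (simp add: a_def)
  qed
  have "S \<le> (\<Sum>T\<in>R. (if T \<in> C then 4 ^ (r * r) * a else 0) + a)" unfolding S by (rule sum_mono[OF le])
  also have "\<dots> = real (card C) * (4 ^ (r * r) * a) + real (card R) * a"
    using finR CR by (simp add: sum.distrib sum.If_cases Int_absorb1)
  finally have 1: "S \<le> real (card C) * (4 ^ (r * r) * a) + real (card R) * a" .
  have "card C * card E \<le> 4 * n * card E ^ r"
    unfolding C_def E_def by (rule card_conflicting)
  then have "real (card C * card E) \<le> real (4 * n * card E ^ r)" by (simp only: of_nat_le_iff)
  then have "real (card C) \<le> 4 * real n / real (card E) * real (card E) ^ r" using E0 by (simp add: field_simps)
  then have "real (card C) * (4 ^ (r * r) * a) \<le> (4 * real n / real (card E) * real (card E) ^ r) * (4 ^ (r * r) * a)"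
    using a0 by (intro mult_right_mono) auto
  also have "\<dots> = 4 * real n / real (card E) * 4 ^ (r * r) * (real (card E) * q ^ (n - 1)) ^ r"
  proof -
    have "a = (q ^ (n - 1)) ^ r" unfolding a_def by (subst mult.commute) (rule power_mult)
    then show ?thesis by (simp add: power_mult_distrib)
  qed
  finally show "S \<le> real (card E choose r) * q ^ (r * (n - 1)) +
      4 * real n / real (card E) * 4 ^ (r * r) * (real (card E) * q ^ (n - 1)) ^ r"
    using 1 by (simp add: cR a_def)
qed

section \<open>The Betti number\<close>

lemma prob_not_robust_tendsto_0:
  assumes p: "eventually (\<lambda>n. 1 / 2 \<le> p n \<and> p n \<le> 1) sequentially"
  shows "(\<lambda>n. measure_pmf.prob (coins (cube_faces n 2) (p n)) {\<omega>. \<not> robust_complex n (present n \<omega>)}) \<longlonglongrightarrow> 0"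
proof (rule squeeze_to_0)
  let ?a = "\<lambda>n. (real n * 2 ^ n) * (5 * real n ^ 5) * ((1 / 10) powr (- (real n / 500)) * (11 / 20) ^ (2 * n - 3))"
  let ?b = "\<lambda>n. (4 ^ n * 2 ^ n) * (15 / 16) powr (real n ^ 2 / 1000000) :: real"
  let ?c = "\<lambda>n. 4 ^ n * ((1 / 4) powr (- (real n ^ 2 / 50)) * (5 / 8) ^ ((n - 2) * (n - 3) div 2)) :: real"
  show "eventually (\<lambda>n. measure_pmf.prob (coins (cube_faces n 2) (p n)) {\<omega>. \<not> robust_complex n (present n \<omega>)}
      \<le> ?a n + ?b n + ?c n) sequentially"
    using p eventually_ge_at_top[of 1000]
  proof eventually_elim
    case (elim n)
    let ?M = "coins (cube_faces n 2) (p n)"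
    let ?A = "{\<omega>. \<not> isolates_sparse_edges n (present n \<omega>)}"
    let ?B = "{\<omega>. \<not> mixes_links n (present n \<omega>)}"
    let ?C = "{\<omega>. \<not> rich_in_double_shifts n (present n \<omega>)}"
    have "{\<omega>. \<not> robust_complex n (present n \<omega>)} \<subseteq> (?A \<union> ?B) \<union> ?C"
      using elim present_subset by (auto simp: robust_complex_def)
    then have "measure_pmf.prob ?M {\<omega>. \<not> robust_complex n (present n \<omega>)} \<le> measure_pmf.prob ?M ((?A \<union> ?B) \<union> ?C)"
      by (rule measure_pmf.finite_measure_mono) simp
    also have "\<dots> \<le> measure_pmf.prob ?M (?A \<union> ?B) + measure_pmf.prob ?M ?C"
      by (rule measure_Un_le) auto
    also have "\<dots> \<le> (measure_pmf.prob ?M ?A + measure_pmf.prob ?M ?B) + measure_pmf.prob ?M ?C"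
      by (intro add_right_mono measure_Un_le) auto
    also have "\<dots> \<le> (?a n + ?b n) + ?c n"
      using elim by (intro add_mono prob_not_isolates_sparse_edges prob_not_mixes_links prob_not_rich_in_double_shifts) auto
    finally show ?case .
  qed
  show "(\<lambda>n. ?a n + ?b n + ?c n) \<longlonglongrightarrow> 0"
    using tendsto_add[OF tendsto_add[OF sparse_bound_tendsto_0 link_bound_tendsto_0] double_shift_bound_tendsto_0] by simp
qed simp

text \<open>
  The lower bound converges since a binomial coefficient is asymptotic to \<open>N ^ r / fact r\<close>; the error term of
  the upper bound vanishes since the number of edges exceeds \<open>n\<close> by an exponential factor.
\<close>

lemma binomial_moment_tendsto:
  fixes p :: "nat \<Rightarrow> real"
  assumes p: "eventually (\<lambda>n. 1 / 2 \<le> p n \<and> p n \<le> 3 / 4) sequentially"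
    and mean: "(\<lambda>n. real (card (cube_faces n 1)) * (1 - p n) ^ (n - 1)) \<longlonglongrightarrow> lam"
  shows "(\<lambda>n. measure_pmf.expectation (coins (cube_faces n 2) (p n))
    (\<lambda>\<omega>. real (card (isolated_edges n (present n \<omega>)) choose r))) \<longlonglongrightarrow> lam ^ r / fact r"
proof -
  let ?E = "\<lambda>n. card (cube_faces n 1)"
  let ?mu = "\<lambda>n. real (?E n) * (1 - p n) ^ (n - 1)"
  let ?L = "\<lambda>n. real (?E n choose r) / real (?E n) ^ r * ?mu n ^ r"
  have E_top: "filterlim ?E at_top sequentially"
  proof (rule filterlim_at_top_mono[OF filterlim_ident])
    show "eventually (\<lambda>n. n \<le> ?E n) sequentially" by (simp only: card_edges) simp
  qed
  have limL: "?L \<longlonglongrightarrow> lam ^ r / fact r"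
    using tendsto_mult[OF filterlim_compose[OF binomial_over_power_tendsto[of r] E_top] tendsto_power[OF mean, of r]] by simp
  have "(\<lambda>n. 4 * real n / (real n * 2 ^ (n - 1))) \<longlonglongrightarrow> 0" by real_asymp
  then have "(\<lambda>n. 4 * real n / real (?E n)) \<longlonglongrightarrow> 0"
    by (simp only: card_edges of_nat_mult of_nat_power of_nat_numeral)
  then have limU: "(\<lambda>n. ?L n + 4 * real n / real (?E n) * 4 ^ (r * r) * ?mu n ^ r) \<longlonglongrightarrow> lam ^ r / fact r + 0 * 4 ^ (r * r) * lam ^ r"
    by (intro tendsto_add tendsto_mult limL tendsto_const tendsto_power mean)
  have bounds: "eventually (\<lambda>n. ?L n \<le> measure_pmf.expectation (coins (cube_faces n 2) (p n))
        (\<lambda>\<omega>. real (card (isolated_edges n (present n \<omega>)) choose r)) \<and>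
      measure_pmf.expectation (coins (cube_faces n 2) (p n))
        (\<lambda>\<omega>. real (card (isolated_edges n (present n \<omega>)) choose r)) \<le>
      ?L n + 4 * real n / real (?E n) * 4 ^ (r * r) * ?mu n ^ r) sequentially"
    using p eventually_ge_at_top[of 1]
  proof eventually_elim
    case (elim n)
    have E0: "0 < real (?E n)" using elim by (simp only: card_edges) simp
    have "?L n = real (?E n choose r) * (1 - p n) ^ (r * (n - 1))"
      using E0 by (simp add: power_mult_distrib mult.commute[of r] power_mult)
    moreover have "1 / 4 \<le> 1 - p n" "1 - p n \<le> 1" "0 \<le> p n" "p n \<le> 1" using elim by auto
    ultimately show ?case
      using binomial_moment_bounds[of "1 - p n" n r] elim by (simp only: binomial_moment_isolated)
  qed
  show ?thesis
    by (rule tendsto_sandwich[OF _ _ limL limU[simplified]]) (use bounds in \<open>auto elim: eventually_mono\<close>)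
qed

theorem corollary1p4:
  fixes c :: real and p :: "nat \<Rightarrow> real" and k :: nat
  assumes "\<And>n. p n = 1 / 2 * (1 + (ln (real n) + c) / real n)"
  shows "(\<lambda>n. measure_pmf.prob (random_cubical_complex n (p n)) {Q. betti Q 1 = k})
           \<longlonglongrightarrow> exp (- (c * real k)) * exp (- exp (- c)) / fact k"
proof -
  let ?M = "\<lambda>n. coins (cube_faces n 2) (p n)"
  let ?I = "\<lambda>n \<omega>. card (isolated_edges n (present n \<omega>))"
  let ?b = "\<lambda>n \<omega>. betti (cube_skeleton n 1 \<union> present n \<omega>) 1"
  let ?bad = "\<lambda>n. {\<omega>. \<not> robust_complex n (present n \<omega>)}"
  define t where "t n = (ln (real n) + c) / real n" for n
  have p_t: "p n = 1 / 2 + t n / 2" for n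
  proof -
    have "p n = 1 / 2 * (1 + t n)" by (simp only: assms t_def)
    then show ?thesis by (simp add: distrib_left)
  qed
  have "eventually (\<lambda>n. t n \<ge> 0) sequentially" unfolding t_def by real_asymp
  moreover have "eventually (\<lambda>n. t n \<le> 1 / 2) sequentially" unfolding t_def by real_asymp
  ultimately have p: "eventually (\<lambda>n. 1 / 2 \<le> p n \<and> p n \<le> 3 / 4) sequentially"
    by eventually_elim (simp add: p_t)
  then have p1: "eventually (\<lambda>n. 1 / 2 \<le> p n \<and> p n \<le> 1) sequentially"
    by eventually_elim simp
  have "(\<lambda>n. real n * (1 - t n) ^ (n - 1)) \<longlonglongrightarrow> exp (- c)" unfolding t_def by real_asymp
  moreover have "real (card (cube_faces n 1)) * (1 - p n) ^ (n - 1) = real n * (1 - t n) ^ (n - 1)" for n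
  proof -
    have "1 - p n = 1 / 2 * (1 - t n)" by (simp add: p_t ring_distribs)
    then show ?thesis by (simp only: card_edges power_mult_distrib) (simp add: power_divide)
  qed
  ultimately have mean: "(\<lambda>n. real (card (cube_faces n 1)) * (1 - p n) ^ (n - 1)) \<longlonglongrightarrow> exp (- c)" by simp
  have "(\<lambda>n. measure_pmf.prob (?M n) {\<omega>. ?I n \<omega> = k}) \<longlonglongrightarrow> exp (- c) ^ k * exp (- exp (- c)) / fact k"
    by (rule poisson_limit_of_binomial_moments[OF finite_set_pmf_coins[OF finite_cube_faces] binomial_moment_tendsto[OF p mean]])
  moreover have "exp (- c) ^ k = exp (- (c * real k))" by (simp add: exp_of_nat_mult[symmetric] mult.commute)
  ultimately have isolated: "(\<lambda>n. measure_pmf.prob (?M n) {\<omega>. ?I n \<omega> = k}) \<longlonglongrightarrow> exp (- (c * real k)) * exp (- exp (- c)) / fact k"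
    by simp
  \<comment> \<open>the two random variables agree outside the bad event\<close>
  have diff: "\<bar>measure_pmf.prob (?M n) {\<omega>. ?b n \<omega> = k} - measure_pmf.prob (?M n) {\<omega>. ?I n \<omega> = k}\<bar>
      \<le> measure_pmf.prob (?M n) (?bad n)" for n
  proof -
    have le: "measure_pmf.prob (?M n) A \<le> measure_pmf.prob (?M n) B + measure_pmf.prob (?M n) (?bad n)"
      if "A \<subseteq> B \<union> ?bad n" for A B
    proof -
      have "measure_pmf.prob (?M n) A \<le> measure_pmf.prob (?M n) (B \<union> ?bad n)"
        by (rule measure_pmf.finite_measure_mono[OF that]) simp
      also have "\<dots> \<le> measure_pmf.prob (?M n) B + measure_pmf.prob (?M n) (?bad n)"
        by (rule measure_Un_le) auto
      finally show ?thesis .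
    qed
    have eq: "?b n \<omega> = ?I n \<omega>" if "\<omega> \<notin> ?bad n" for \<omega>
      using robust_complex.betti_eq_isolated[of n "present n \<omega>"] that by simp
    have "measure_pmf.prob (?M n) {\<omega>. ?b n \<omega> = k} \<le> measure_pmf.prob (?M n) {\<omega>. ?I n \<omega> = k} + measure_pmf.prob (?M n) (?bad n)"
      by (rule le) (use eq in auto)
    moreover have "measure_pmf.prob (?M n) {\<omega>. ?I n \<omega> = k} \<le> measure_pmf.prob (?M n) {\<omega>. ?b n \<omega> = k} + measure_pmf.prob (?M n) (?bad n)"
      by (rule le) (use eq in auto)
    ultimately show ?thesis by linarith
  qed
  have "(\<lambda>n. measure_pmf.prob (?M n) {\<omega>. ?b n \<omega> = k} - measure_pmf.prob (?M n) {\<omega>. ?I n \<omega> = k}) \<longlonglongrightarrow> 0"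
    by (rule tendsto_rabs_zero_cancel, rule squeeze_to_0[OF _ _ prob_not_robust_tendsto_0[OF p1]])
      (use diff in auto)
  from tendsto_add[OF this isolated]
  have "(\<lambda>n. measure_pmf.prob (?M n) {\<omega>. ?b n \<omega> = k}) \<longlonglongrightarrow> exp (- (c * real k)) * exp (- exp (- c)) / fact k"
    by simp
  moreover have "measure_pmf.prob (random_cubical_complex n (p n)) {Q. betti Q 1 = k} = measure_pmf.prob (?M n) {\<omega>. ?b n \<omega> = k}" for n
    by (simp add: random_cubical_complex_def present_def vimage_def)
  ultimately show ?thesis by simp
qed

end
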